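(* Let $n\ge 8$. The maximum number of vertices of degree $n-4$ in an almost peripheral graph of order $n$ with maximum degree $n-4$ is $n-5$. This maximum is attained uniquely (up to isomorphism) by the following graph: let $H$ be the graph of order $7$ obtained from $K_4$ on vertices $h,a,b,c$ by subdividing each of the edges $ab$, $bc$, $ca$ exactly once; then replace the vertex $a$ by a complete graph $K_{n-6}$, joining every vertex of this $K_{n-6}$ to every neighbor of $a$ in $H$.
   Context: All graphs are finite and simple. For a connected graph $G$, the eccentricity of a vertex $v$ is $\max_{u\in V(G)} d(v,u)$; the diameter is the maximum eccentricity. A peripheral vertex is one whose eccentricity equals the diameter. A connected graph of order $n$ is almost peripheral if it has exactly $n-1$ peripheral vertices. Subdividing an edge $xy$ once means replacing it by a path $x,s,y$ through a new vertex $s$. *)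

theory Defs
  imports "Graph_Theory.Graph_Theory"
begin

text \<open>
  Finite simple graphs are the symmetric loop-free finite digraphs given by \<^locale>\<open>pair_graph\<close>:
  an edge \<open>xy\<close> is the pair of arcs \<open>(x,y)\<close>, \<open>(y,x)\<close>. Hence the degree of a vertex is its
  \<^const>\<open>out_degree\<close>, and isomorphism is \<^const>\<open>digraph_iso\<close>.
\<close>

text \<open>
  \<^const>\<open>wf_digraph.\<mu>\<close> with unit costs is the length of a shortest walk, as an \<^typ>\<open>ereal\<close>
  (infinite if there is none).
\<close>

definition vertex_dist :: "('a,'b) pre_digraph \<Rightarrow> 'a \<Rightarrow> 'a \<Rightarrow> ereal" where
  "vertex_dist G u v = wf_digraph.\<mu> G (\<lambda>_. 1) u v"

definition eccentricity :: "('a,'b) pre_digraph \<Rightarrow> 'a \<Rightarrow> ereal" where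
  "eccentricity G v = Max (vertex_dist G v ` verts G)"

definition graph_diameter :: "('a,'b) pre_digraph \<Rightarrow> ereal" where
  "graph_diameter G = Max (eccentricity G ` verts G)"

definition peripheral_verts :: "('a,'b) pre_digraph \<Rightarrow> 'a set" where
  "peripheral_verts G = {v \<in> verts G. eccentricity G v = graph_diameter G}"

definition almost_peripheral :: "('a,'b) pre_digraph \<Rightarrow> bool" where
  "almost_peripheral G \<longleftrightarrow>
     connected G \<and> card (peripheral_verts G) = card (verts G) - 1"

definition max_degree :: "('a,'b) pre_digraph \<Rightarrow> nat" where
  "max_degree G = Max (out_degree G ` verts G)"

definition verts_of_degree :: "('a,'b) pre_digraph \<Rightarrow> nat \<Rightarrow> 'a set" where
  "verts_of_degree G d = {v \<in> verts G. out_degree G v = d}"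

definition ap_graph :: "nat \<Rightarrow> nat \<Rightarrow> 'a pair_pre_digraph \<Rightarrow> bool" where
  "ap_graph n d G \<longleftrightarrow>
     pair_graph G \<and> card (pverts G) = n \<and>
     almost_peripheral (with_proj G) \<and> max_degree (with_proj G) = d"

definition complete_on :: "'a set \<Rightarrow> 'a pair_pre_digraph" where
  "complete_on S = \<lparr> pverts = S, parcs = {(u,v). u \<in> S \<and> v \<in> S \<and> u \<noteq> v} \<rparr>"

text \<open>Only meaningful if \<open>S\<close> is disjoint from the vertices of \<open>G\<close>.\<close>

definition replace_by_complete ::
  "'a pair_pre_digraph \<Rightarrow> 'a \<Rightarrow> 'a set \<Rightarrow> 'a pair_pre_digraph" where
  "replace_by_complete G a S =
     \<lparr> pverts = (pverts G - {a}) \<union> S,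
       parcs = {(u,v) \<in> parcs G. u \<noteq> a \<and> v \<noteq> a} \<union> parcs (complete_on S)
         \<union> {(s,w) | s w. s \<in> S \<and> (a,w) \<in> parcs G}
         \<union> {(w,s) | s w. s \<in> S \<and> (w,a) \<in> parcs G} \<rparr>"

text \<open>
  \<open>VH\<close>, \<open>VA\<close>, \<open>VB\<close>, \<open>VC\<close> are the vertices \<open>h\<close>, \<open>a\<close>, \<open>b\<close>, \<open>c\<close> of $K_4$; \<open>SAB\<close>, \<open>SBC\<close>, \<open>SCA\<close>
  are the subdividing vertices; \<open>Clone i\<close> are the vertices of the complete graph replacing \<open>a\<close>.
\<close>

datatype ext_vertex = VH | VA | VB | VC | SAB | SBC | SCA | Clone nat

definition subdivided_K4 :: "ext_vertex pair_pre_digraph" where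
  "subdivided_K4 =
     subdivide (subdivide (subdivide (complete_on {VH, VA, VB, VC})
       (VA, VB) SAB) (VB, VC) SBC) (VC, VA) SCA"

definition extremal_graph :: "nat \<Rightarrow> ext_vertex pair_pre_digraph" where
  "extremal_graph n = replace_by_complete subdivided_K4 VA (Clone ` {..<n - 6})"

end

theory Submission
  imports Defs
begin

text \<open>
  Let \<open>z\<close> be the only non-peripheral vertex and suppose that at least \<open>n - 5\<close> vertices have
  degree \<open>n - 4\<close>; call these big. The eccentricity of a big vertex \<open>v \<noteq> z\<close> cannot be two, since \<open>z\<close>
  would then be universal, and it cannot be four, since the last vertices of a shortest path
  from \<open>v\<close> would contain two non-peripheral ones. So the diameter is three. A vertex \<open>w\<close> at distance
  three from \<open>v\<close> has its closed neighbourhood inside the three non-neighbours of \<open>v\<close>; a leaf \<open>w\<close> would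
  have to hang at \<open>z\<close>, which is impossible, so \<open>w\<close> has two neighbours \<open>p, q\<close> and \<open>{w, p, q}\<close> is the set
  of non-neighbours of \<open>v\<close>. Two different such triples would leave some vertex other than \<open>z\<close> within
  distance two of everything, or too few big vertices. With a single common triple at most three
  vertices remain besides the triple and the big vertices other than \<open>z\<close>. One of them is \<open>z\<close>, which
  must be adjacent to \<open>p\<close> and \<open>q\<close>; the vertices far from \<open>p\<close> and from \<open>q\<close> are the other two, and all
  adjacencies are forced.
\<close>

section \<open>Vertices of degree \<open>n - 4\<close> in diameter three\<close>

text \<open>Encodes distance at most \<open>k\<close> by a recursion that unfolds for
  \<open>k = 2\<close> and \<open>k = 3\<close> into plain adjacency statements, which keeps
  extended reals out of the combinatorial part.\<close>

fun walk_le :: "'a rel \<Rightarrow> nat \<Rightarrow> 'a \<Rightarrow> 'a \<Rightarrow> bool" where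
  "walk_le E 0 u v \<longleftrightarrow> u = v"
| "walk_le E (Suc k) u v \<longleftrightarrow> u = v \<or> (\<exists>x. (u,x) \<in> E \<and> walk_le E k x v)"

context pair_graph begin

abbreviation adj :: "'a \<Rightarrow> 'a \<Rightarrow> bool" (infix "\<sim>" 50) where "u \<sim> v \<equiv> (u,v) \<in> parcs G"
abbreviation nbrs :: "'a \<Rightarrow> 'a set" where "nbrs v \<equiv> parcs G `` {v}"
abbreviation near :: "'a \<Rightarrow> 'a \<Rightarrow> bool" where "near \<equiv> walk_le (parcs G) 2"

lemma near_iff: "near u v \<longleftrightarrow> u = v \<or> u \<sim> v \<or> (\<exists>x. u \<sim> x \<and> x \<sim> v)"
  by (auto simp: numeral_2_eq_2)

lemma walk_le_three_iff: "walk_le (parcs G) 3 u v \<longleftrightarrow> u = v \<or> (\<exists>x. u \<sim> x \<and> near x v)"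
  by (simp add: numeral_3_eq_3 numeral_2_eq_2)

lemma adj_sym: "u \<sim> v \<longleftrightarrow> v \<sim> u"
  using arcs_symmetric by blast

lemma adj_irrefl [simp]: "\<not> u \<sim> u"
  using no_loops' by blast

lemma adj_in_verts: "u \<sim> v \<Longrightarrow> u \<in> pverts G \<and> v \<in> pverts G"
  using in_arcsD1 in_arcsD2 by blast

lemma near_sym: "near u v \<longleftrightarrow> near v u"
  unfolding near_iff using adj_sym by blast

lemma nbrs_subset: "nbrs v \<subseteq> pverts G - {v}"
  by (auto dest: adj_in_verts)

lemma finite_nbrs: "finite (nbrs v)"
  by (rule finite_subset[OF _ pair_finite_verts]) (auto dest: adj_in_verts)

lemma card_non_nbrs:
  assumes "v \<in> pverts G"
  shows "card (pverts G - {v} - nbrs v) + card (nbrs v) + 1 = card (pverts G)"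
proof -
  have "card (pverts G - {v} - nbrs v) = card (pverts G - {v}) - card (nbrs v)"
    by (rule card_Diff_subset[OF finite_nbrs]) (auto dest: adj_in_verts)
  moreover have "card (nbrs v) \<le> card (pverts G - {v})"
    by (rule card_mono) (auto dest: adj_in_verts simp: pair_finite_verts)
  moreover have "card (pverts G - {v}) = card (pverts G) - 1" "card (pverts G) > 0"
    using assms pair_finite_verts by (auto simp: card_gt_0_iff)
  ultimately show ?thesis by linarith
qed

text \<open>At distance above two the closed neighbourhoods are disjoint, and together they would
  have more elements than there are vertices.\<close>

lemma near_if_large_degrees:
  assumes "u \<in> pverts G" "v \<in> pverts G"
    and "card (pverts G) < card (nbrs u) + card (nbrs v) + 2"
  shows "near u v"
proof (rule ccontr)
  assume "\<not> near u v"
  then have disj: "insert u (nbrs u) \<inter> insert v (nbrs v) = {}"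
    unfolding near_iff using adj_sym by auto
  have "card (insert u (nbrs u) \<union> insert v (nbrs v)) = (card (nbrs u) + 1) + (card (nbrs v) + 1)"
    using disj finite_nbrs by (subst card_Un_disjoint) auto
  moreover have "card (insert u (nbrs u) \<union> insert v (nbrs v)) \<le> card (pverts G)"
    by (rule card_mono[OF pair_finite_verts]) (use assms adj_in_verts in auto)
  ultimately show False using assms(3) by simp
qed

end

text \<open>\<open>z\<close> is the only non-peripheral vertex of a graph whose diameter is three.\<close>

locale critical_graph = pair_graph +
  fixes z
  assumes order: "8 \<le> card (pverts G)"
    and z_vert: "z \<in> pverts G"
    and z_near: "v \<in> pverts G \<Longrightarrow> near z v"
    and not_near: "v \<in> pverts G \<Longrightarrow> v \<noteq> z \<Longrightarrow> \<exists>w\<in>pverts G. \<not> near v w"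
    and diam_three: "u \<in> pverts G \<Longrightarrow> v \<in> pverts G \<Longrightarrow> walk_le (parcs G) 3 u v"
    and many: "card (pverts G) - 5
      \<le> card {v \<in> pverts G. card (nbrs v) = card (pverts G) - 4}"
begin

section \<open>Far vertices and non-neighbours of vertices of degree \<open>n - 4\<close>\<close>

definition big :: "'a set" where
  "big = {v \<in> pverts G. card (nbrs v) = card (pverts G) - 4}"

text \<open>The center \<open>z\<close> may itself have degree \<open>n - 4\<close>, but no vertex
  is at distance three from it; arguments through far vertices apply to the others only.\<close>

definition bigs :: "'a set" where
  "bigs = big - {z}"

lemma bigs_iff: "v \<in> bigs \<longleftrightarrow> v \<in> pverts G \<and> v \<noteq> z \<and> card (nbrs v) = card (pverts G) - 4"
  by (auto simp: bigs_def big_def)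

lemma finite_big: "finite big" "finite bigs"
  using pair_finite_verts by (auto simp: big_def bigs_def)

lemma card_big: "card (pverts G) - 5 \<le> card big"
  using many by (simp add: big_def)

lemma card_bigs: "card (pverts G) - 6 \<le> card bigs" "z \<notin> big \<Longrightarrow> card (pverts G) - 5 \<le> card bigs"
  using card_big card_Diff1_le[of big z] finite_big
  by (auto simp: bigs_def card_Diff_singleton_if)

lemma non_nbrs_big: "v \<in> big \<Longrightarrow> card (pverts G - {v} - nbrs v) = 3"
  using card_non_nbrs[of v] order by (auto simp: big_def)

text \<open>Here 2(n - 4) + 2 > n, because n > 6.\<close>

lemma big_near: "u \<in> big \<Longrightarrow> v \<in> big \<Longrightarrow> near u v"
  by (rule near_if_large_degrees) (use order in \<open>auto simp: big_def\<close>)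

text \<open>Every walk from the leaf \<open>w\<close> starts through \<open>x\<close>, so diameter
  three puts all vertices within distance two of \<open>x\<close>; only \<open>z\<close> has this
  property.\<close>

lemma leaf_at_center:
  assumes "w \<noteq> z" "nbrs w = {x}"
  shows "x = z"
proof (rule ccontr)
  assume "x \<noteq> z"
  have wx: "w \<sim> x" using assms(2) by blast
  then obtain y where y: "y \<in> pverts G" "\<not> near x y"
    using not_near[of x] \<open>x \<noteq> z\<close> adj_in_verts by blast
  have "w \<noteq> y" using y wx near_iff adj_sym by blast
  then have "\<exists>x'. w \<sim> x' \<and> near x' y"
    using diam_three[of w y] y wx adj_in_verts walk_le_three_iff by blast
  then show False using assms y by (metis Image_singleton_iff singletonD)
qed

lemma nbrs_nonempty:
  assumes "w \<in> pverts G" shows "nbrs w \<noteq> {}"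
proof -
  obtain v where "v \<in> pverts G" "v \<noteq> w"
  proof -
    have "pverts G \<noteq> {w}" using order by auto
    then show thesis using that assms by blast
  qed
  then show ?thesis using diam_three[OF assms, of v] walk_le_three_iff by auto
qed

text \<open>\<open>w\<close> is at distance three from the vertex \<open>v\<close> of degree \<open>n - 4\<close>, and its closed neighbourhood
  \<open>{w, p, q}\<close> is exactly the set of non-neighbours of \<open>v\<close>.\<close>

definition triple :: "'a \<Rightarrow> 'a \<Rightarrow> 'a \<Rightarrow> 'a \<Rightarrow> bool" where
  "triple v w p q \<longleftrightarrow> {v,w,p,q} \<subseteq> pverts G \<and> distinct [v,w,p,q]
     \<and> nbrs v = pverts G - {v,w,p,q} \<and> nbrs w = {p,q}"

text \<open>Both \<open>w\<close> and \<open>z\<close> turn out to be non-neighbours of every vertex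
  of \<open>bigs\<close>, which leaves each of them one further non-neighbour \<open>t x\<close>.
  This forces one vertex \<open>u\<close> to be far from all neighbours of \<open>z\<close> except
  \<open>w\<close>, so \<open>z\<close> cannot come within distance two of \<open>u\<close>.\<close>

lemma no_leaf:
  assumes v: "v \<in> bigs" and w: "w \<in> pverts G" "\<not> near v w" and leaf: "nbrs w = {z}"
  shows False
proof -
  have wz: "w \<noteq> z" using leaf by (metis Image_singleton_iff adj_irrefl singletonI)
  have zw: "z \<sim> w" using leaf adj_sym by blast
  text \<open>Otherwise a vertex \<open>w'\<close> far from \<open>x\<close> would not be adjacent to \<open>z\<close>, hence not a leaf, so \<open>w\<close>,
    \<open>w'\<close> and two neighbours of \<open>w'\<close> would be four non-neighbours of \<open>x\<close>.\<close>
  have nz: "\<not> x \<sim> z" if x: "x \<in> bigs" for x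
  proof
    assume xz: "x \<sim> z"
    obtain w' where w': "w' \<in> pverts G" "\<not> near x w'" using not_near x bigs_iff by blast
    have w'z: "w' \<noteq> z" "\<not> w' \<sim> z" using xz w' near_iff adj_sym by blast+
    have xw: "\<not> x \<sim> w" "x \<noteq> w"
    proof -
      show "\<not> x \<sim> w"
        by (metis Image_singleton_iff adj_sym leaf singletonD x bigs_iff)
      show "x \<noteq> w"
      proof
        assume "x = w"
        then show False using big_near[of v w] v x w by (auto simp: bigs_def)
      qed
    qed
    have ww': "\<not> w \<sim> w'" "w \<noteq> w'"
      using w'z leaf by auto
    have sub: "insert w (insert w' (nbrs w')) \<subseteq> pverts G - {x} - nbrs x"
      using w' near_iff adj_sym adj_in_verts xw w by fastforce
    have "card (insert w (insert w' (nbrs w'))) = card (nbrs w') + 2"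
      using finite_nbrs ww' adj_sym by (subst card_insert_disjoint; auto)+
    then have "card (nbrs w') + 2 \<le> 3"
      using card_mono[OF _ sub] pair_finite_verts non_nbrs_big[of x] x by (auto simp: bigs_def)
    moreover have "card (nbrs w') \<noteq> 0" using nbrs_nonempty[OF w'(1)] finite_nbrs by auto
    ultimately have "card (nbrs w') = 1" by linarith
    then obtain y where "nbrs w' = {y}" using card_1_singletonE by blast
    then show False using leaf_at_center[of w' y] w'z by blast
  qed
  have "\<exists>t. pverts G - {x} - nbrs x = {w,z,t} \<and> t \<noteq> w \<and> t \<noteq> z" if x: "x \<in> bigs" for x
  proof -
    have xw: "\<not> x \<sim> w" "x \<noteq> w"
      using leaf adj_sym x bigs_iff nz big_near[of v x] v w by (auto simp: bigs_def)
    have sub: "{w,z} \<subseteq> pverts G - {x} - nbrs x" using xw nz[OF x] x bigs_iff w z_vert by auto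
    have "card (pverts G - {x} - nbrs x - {w,z}) = 1"
      using non_nbrs_big[of x] x wz card_Diff_subset[OF _ sub] by (simp add: bigs_def)
    then obtain t where "pverts G - {x} - nbrs x - {w,z} = {t}" using card_1_singletonE by blast
    then have "pverts G - {x} - nbrs x = {w,z,t} \<and> t \<noteq> w \<and> t \<noteq> z" using sub by blast
    then show ?thesis ..
  qed
  then obtain t where t: "\<And>x. x \<in> bigs \<Longrightarrow> pverts G - {x} - nbrs x = {w,z,t x} \<and> t x \<noteq> w \<and> t x \<noteq> z"
    by metis
  have adj: "x \<sim> y" if "x \<in> bigs" "y \<in> pverts G" "y \<noteq> x" "y \<noteq> w" "y \<noteq> z" "y \<noteq> t x" for x y
    using t[OF that(1)] that by blast
  have tnadj: "\<not> x \<sim> t x" "t x \<noteq> x" "t x \<in> pverts G" if "x \<in> bigs" for x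
    using t[OF that] by blast+
  \<comment> \<open>Vertices at distance two from \<open>z\<close> are reached through
    \<open>Y\<close>, because the leaf \<open>w\<close> only leads back to \<open>z\<close>.\<close>
  define Y where "Y = nbrs z - {w}"
  have Y: "y \<in> pverts G" "y \<noteq> z" "y \<noteq> w" "z \<sim> y" "y \<notin> bigs" if "y \<in> Y" for y
    using that nz adj_in_verts adj_sym by (auto simp: Y_def)
  have "\<exists>u\<in>pverts G. \<not> near y u" if "y \<in> Y" for y
    using not_near Y that by blast
  then obtain f where f: "\<And>y. y \<in> Y \<Longrightarrow> f y \<in> pverts G \<and> \<not> near y (f y)" by metis
  have fz: "f y \<noteq> z" "f y \<noteq> w" "\<not> z \<sim> f y" "f y \<notin> Y" if "y \<in> Y" for y
  proof -
    show *: "f y \<noteq> z" "f y \<noteq> w" "\<not> z \<sim> f y"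
      using f[OF that] Y[OF that] zw unfolding near_iff using adj_sym by blast+
    show "f y \<notin> Y" using * by (simp add: Y_def)
  qed
  \<comment> \<open>If \<open>x\<close> were adjacent to both \<open>y\<close> and
    \<open>f y\<close>, these would be at distance at most two; hence the one free non-neighbour of
    \<open>x\<close> is among them.\<close>
  have tf: "t x = f y \<or> t x = y" if "x \<in> bigs" "y \<in> Y" "x \<noteq> f y" for x y
  proof (rule ccontr)
    assume "\<not> ?thesis"
    then have "x \<sim> f y" "x \<sim> y"
      using adj[OF that(1)] f fz Y that by metis+
    then show False using f[OF that(2)] near_iff adj_sym by blast
  qed
  have vy: "\<exists>y\<in>Y. x \<sim> y" if xb: "x \<in> bigs" for x
  proof -
    have "near x z" using z_near xb bigs_iff near_sym by blast
    then obtain y where "x \<sim> y" "y \<sim> z" using nz[OF xb] xb unfolding near_iff bigs_iff by blast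
    moreover have "y \<noteq> w" using t[OF xb] \<open>x \<sim> y\<close> by blast
    ultimately show ?thesis using adj_sym by (auto simp: Y_def)
  qed
  \<comment> \<open>If \<open>f y\<close> were in \<open>bigs\<close>, its free non-neighbour would
    be \<open>y\<close>, so it would be adjacent to \<open>x\<close>; but \<open>x\<close>, being
    adjacent to \<open>y\<close>, has to miss \<open>f y\<close>.\<close>
  have notbig: "\<not> f y \<in> bigs" if "y \<in> Y" "x \<in> bigs" "x \<sim> y" for x y
  proof
    assume fb: "f y \<in> bigs"
    have "f y \<noteq> x" using f that unfolding near_iff using adj_sym by blast
    have "t (f y) = y"
      using f[OF that(1)] adj[OF fb, of y] Y[OF that(1)] unfolding near_iff using adj_sym by metis
    moreover have "t x = f y"
      using tf[of x y] that tnadj \<open>f y \<noteq> x\<close> by metis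
    ultimately have "\<not> f y \<sim> x" using adj_sym tnadj that by metis
    then show False using adj[OF fb, of x] \<open>t (f y) = y\<close> \<open>f y \<noteq> x\<close> that Y bigs_iff
      t[OF that(2)] by (metis insertCI DiffE insertI1)
  qed
  obtain y0 where y0: "y0 \<in> Y" "v \<sim> y0" using vy v by blast
  define u where "u = f y0"
  have tv: "t v = u" using tf[of v y0] tnadj[OF v] notbig y0 v u_def by metis
  have ub: "u \<notin> bigs" using notbig y0 v u_def by blast
  \<comment> \<open>If \<open>v\<close> is adjacent to \<open>y\<close>, then
    \<open>f y = t v = u\<close>; otherwise \<open>y = t v = u\<close>, although \<open>u\<close> is
    not in \<open>Y\<close>.\<close>
  have fu: "\<not> near y u" if y: "y \<in> Y" for y
  proof (cases "v \<sim> y")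
    case True
    then have "t v = f y" using tf[of v y] tnadj[OF v] notbig y v by metis
    then show ?thesis using f y tv by simp
  next
    case False
    then have "y = t v" using adj[OF v, of y] Y[OF y] v by metis
    then show ?thesis using fz(4)[OF y0(1)] y tv u_def by simp
  qed
  have "near z u" using z_near f y0 u_def by blast
  then obtain y where "z \<sim> y" "y \<sim> u" using fz[OF y0(1)] unfolding u_def near_iff by blast
  moreover have "y \<noteq> w" using fz(1)[OF y0(1)] leaf \<open>y \<sim> u\<close> unfolding u_def by blast
  ultimately show False using fu[of y] near_iff Y_def by blast
qed

text \<open>The closed neighbourhood of a far vertex \<open>w\<close> lies among the three
  non-neighbours of \<open>v\<close>. Degree zero contradicts finite diameter, and degree one makes
  \<open>w\<close> a leaf at \<open>z\<close>; so \<open>w\<close> has degree two and its closed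
  neighbourhood fills all three places.\<close>

lemma triple_exists:
  assumes v: "v \<in> bigs"
  shows "\<exists>w p q. triple v w p q"
proof -
  obtain w where w: "w \<in> pverts G" "\<not> near v w" using not_near v bigs_iff by blast
  have wz: "w \<noteq> z" using w z_near near_sym v bigs_iff by blast
  have sub: "insert w (nbrs w) \<subseteq> pverts G - {v} - nbrs v"
    using w near_iff adj_sym adj_in_verts by fastforce
  have "card (nbrs w) \<noteq> 1"
    using no_leaf[OF v w] leaf_at_center[OF wz] by (metis card_1_singletonE)
  moreover have "card (nbrs w) \<noteq> 0" using nbrs_nonempty[OF w(1)] finite_nbrs by auto
  moreover have c: "card (insert w (nbrs w)) = card (nbrs w) + 1" using finite_nbrs by simp
  moreover have "card (insert w (nbrs w)) \<le> 3"
    using card_mono[OF _ sub] pair_finite_verts non_nbrs_big[of v] v by (auto simp: bigs_def)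
  ultimately have c2: "card (nbrs w) = 2" by linarith
  then obtain p q where pq: "nbrs w = {p,q}" "p \<noteq> q" by (auto simp: card_2_iff)
  have eq: "insert w (nbrs w) = pverts G - {v} - nbrs v"
    by (rule card_subset_eq[OF _ sub]) (use pair_finite_verts non_nbrs_big[of v] v c c2 in \<open>auto simp: bigs_def\<close>)
  have "w \<sim> p" "w \<sim> q" using pq by auto
  moreover have "nbrs v = pverts G - {v,w,p,q}"
  proof -
    have "nbrs v = pverts G - {v} - insert w (nbrs w)"
      unfolding eq by (rule double_diff[OF nbrs_subset order_refl, symmetric])
    then show ?thesis unfolding pq(1) by (rule trans[OF _ Diff_insert2[symmetric]])
  qed
  moreover have "v \<noteq> w" "v \<noteq> p" "v \<noteq> q" using w pq near_iff adj_sym by blast+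
  moreover have "w \<noteq> p" "w \<noteq> q" using \<open>w \<sim> p\<close> \<open>w \<sim> q\<close> by auto
  ultimately have "triple v w p q"
    unfolding triple_def using pq v w adj_in_verts[of w] adj_irrefl[of w] by (simp add: bigs_iff)
  then show ?thesis by blast
qed

end

section \<open>Comparing the triples of two vertices\<close>

context critical_graph begin

text \<open>Serves to rule out vertices of degree two or three as members of
  \<open>big\<close>.\<close>

lemma big_degree: "v \<in> big \<Longrightarrow> 4 \<le> card (nbrs v)"
  using order by (auto simp: big_def)

lemma triple_swap: "triple v w p q \<Longrightarrow> triple v w q p"
  by (auto simp: triple_def)

lemma triple_adj: "triple v w p q \<Longrightarrow> v \<sim> x \<longleftrightarrow> x \<in> pverts G \<and> x \<notin> {v,w,p,q}"
  unfolding triple_def by blast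

lemma triple_far_adj: "triple v w p q \<Longrightarrow> w \<sim> x \<longleftrightarrow> x = p \<or> x = q"
  unfolding triple_def by blast

lemma triple_not_near:
  assumes "triple v w p q" shows "\<not> near v w"
proof -
  have "v \<noteq> w" using assms by (simp add: triple_def)
  then show ?thesis
    unfolding near_iff using triple_adj[OF assms] triple_far_adj[OF assms] adj_sym[of w] by auto
qed

lemma triple_far_small:
  assumes "triple v w p q" shows "w \<notin> big"
proof -
  have "card (nbrs w) = 2" using assms by (simp add: triple_def)
  then show ?thesis using big_degree[of w] by linarith
qed

lemma triple_far_not_center: "triple v w p q \<Longrightarrow> w \<noteq> z"
  using triple_not_near z_near near_sym unfolding triple_def by (metis insert_subset)

text \<open>Different third vertices \<open>q\<close> and \<open>q'\<close> would be far from each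
  other. Yet \<open>z\<close> needs \<open>q\<close> to come within distance two of \<open>w\<close>
  and \<open>q'\<close> to come within distance two of \<open>w'\<close>, so it would be a common
  neighbour.\<close>

lemma adjacent_far_agree:
  assumes "triple v w w' q" "triple v' w' w q'"
  shows "q = q'"
proof (rule ccontr)
  assume ne: "q \<noteq> q'"
  \<comment> \<open>The vertex \<open>q'\<close> is adjacent to \<open>v\<close>, which sees
    everything but \<open>w\<close>, \<open>w'\<close>, \<open>q\<close>, and it is adjacent to
    \<open>w'\<close>, which sees \<open>w\<close>; only \<open>q\<close> can be far from it. The
    names are generalized so that the two triples can be exchanged.\<close>
  have no_far: "\<not> near q' q \<and> q \<noteq> z"
    if t: "triple v w w' q" "triple v' w' w q'" "q \<noteq> q'" "q' \<noteq> z" for v v' w w' q q'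
  proof -
    have V: "q' \<in> pverts G" "q' \<noteq> w" "q' \<noteq> w'" using t(2) by (auto simp: triple_def)
    have "q' \<noteq> v" using triple_adj[OF t(1), of w'] triple_far_adj[OF t(2), of v] adj_sym by auto
    then have vq: "v \<sim> q'" using triple_adj[OF t(1)] V t(3) by auto
    obtain y where y: "y \<in> pverts G" "\<not> near q' y" using not_near V t(4) by blast
    have "\<not> v \<sim> y" "y \<noteq> v" using y vq unfolding near_iff using adj_sym by blast+
    moreover have "y \<noteq> w" "y \<noteq> w'"
      using y triple_far_adj[OF t(2)] unfolding near_iff using adj_sym by blast+
    ultimately have "y = q" using y(1) triple_adj[OF t(1)] by blast
    then show ?thesis using y z_near near_sym V by blast
  qed
  have "q' \<noteq> z \<and> q \<noteq> z" using no_far assms ne by metis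
  then have nq: "\<not> near q' q" "q \<noteq> z" "q' \<noteq> z" using no_far assms ne by blast+
  have zz: "w \<noteq> z" "w' \<noteq> z" using assms triple_far_not_center by blast+
  have zw: "near z w" "near z w'" using z_near assms by (auto simp: triple_def)
  have "z \<sim> q"
    using zw(1) zz nq triple_far_adj[OF assms(1)] triple_far_adj[OF assms(2)] adj_sym unfolding near_iff by metis
  moreover have "z \<sim> q'"
    using zw(2) zz nq triple_far_adj[OF assms(1)] triple_far_adj[OF assms(2)] adj_sym unfolding near_iff by metis
  ultimately show False using nq(1) near_iff adj_sym by blast
qed

text \<open>Every vertex of \<open>X\<close> sees both \<open>v\<close> and \<open>v'\<close>, so
  only a common third vertex \<open>q = q'\<close> can be far from it. This bounds the degrees of
  \<open>z\<close> and \<open>q\<close> by three and leaves no big vertices except \<open>v\<close>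
  and \<open>v'\<close>, fewer than the required \<open>n - 5\<close>.\<close>

lemma nonadjacent_far_impossible:
  assumes v: "v \<in> bigs" "v' \<in> bigs" and t: "triple v w v' q" "triple v' w' v q'"
    and ne: "w \<noteq> w'" "w' \<noteq> q" "w \<noteq> q'"
  shows False
proof -
  have V: "v \<in> pverts G" "v' \<in> pverts G" "w \<in> pverts G" "w' \<in> pverts G" "q \<in> pverts G" "q' \<in> pverts G"
    and d: "v \<noteq> w" "v \<noteq> v'" "v \<noteq> q" "w \<noteq> v'" "w \<noteq> q" "v' \<noteq> q" "v' \<noteq> w'" "v' \<noteq> q'" "w' \<noteq> v" "w' \<noteq> q'" "v \<noteq> q'"
    using t by (auto simp: triple_def)
  have vz: "v \<noteq> z" "v' \<noteq> z" using v by (auto simp: bigs_iff)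
  have wz: "w \<noteq> z" "w' \<noteq> z" using t triple_far_not_center by blast+
  note va = triple_adj[OF t(1)] and va' = triple_adj[OF t(2)]
  note wa = triple_far_adj[OF t(1)] and wa' = triple_far_adj[OF t(2)]
  define X where "X = pverts G - {w,w',v,v',q,q',z}"
  \<comment> \<open>At most seven vertices are named, so order at least eight leaves one for
    \<open>X\<close>.\<close>
  have "card {w,w',v,v',q,q',z} \<le> 7"
    by (rule card_insert_le_m1; simp?)+
  then have "card {w,w',v,v',q,q',z} < card (pverts G)" using order by linarith
  then obtain x where "x \<in> X"
    using card_mono[of "{w,w',v,v',q,q',z}" "pverts G"] unfolding X_def
    by (meson DiffI finite.emptyI finite.insertI linorder_not_less subsetI)
  have X: "x \<in> pverts G" "v \<sim> x" "v' \<sim> x" "x \<noteq> z" if "x \<in> X" for x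
    using that va va' by (auto simp: X_def)
  have far_q: "y = q \<and> q = q'" if x: "x \<in> X" and y: "y \<in> pverts G" "\<not> near x y" for x y
  proof -
    have "\<not> v \<sim> y" "y \<noteq> v" "\<not> v' \<sim> y" "y \<noteq> v'"
      using y X[OF x] unfolding near_iff using adj_sym by blast+
    then show ?thesis using y va va' ne d by blast
  qed
  have nq: "\<not> near x q \<and> q = q'" if "x \<in> X" for x
    using far_q not_near X that by metis
  have qq: "q' = q" using nq \<open>x \<in> X\<close> by blast
  have qz: "q \<noteq> z" using nq[OF \<open>x \<in> X\<close>] z_near X[OF \<open>x \<in> X\<close>] near_sym by blast
  have mem: "y \<in> {w,w',v,v',q,z} \<or> y \<in> X" if "y \<in> pverts G" for y
    using that by (auto simp: X_def qq)
  have nqv: "\<not> q \<sim> v" "\<not> q \<sim> v'" using va va' adj_sym qq by auto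
  have nqX: "\<not> q \<sim> y" if "y \<in> X" for y using nq[OF that] near_iff adj_sym by blast
  have nzw: "\<not> z \<sim> w" "\<not> z \<sim> w'" using wa wa' adj_sym vz qz qq by metis+
  have zq: "z \<sim> q"
  proof -
    have "near z q" using z_near V by blast
    moreover have "\<not> (z \<sim> y \<and> y \<sim> q)" for y
    proof
      assume y: "z \<sim> y \<and> y \<sim> q"
      then have "y \<in> {w,w',v,v',q,z} \<or> y \<in> X" using mem adj_in_verts by blast
      then show False using y nzw nqv nqX adj_sym adj_irrefl by (metis empty_iff insert_iff)
    qed
    ultimately show ?thesis using qz unfolding near_iff by blast
  qed
  have nzX: "\<not> z \<sim> y" if "y \<in> X" for y
    using nq[OF that] zq near_iff adj_sym by blast
  have "nbrs z \<subseteq> {v,v',q}"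
  proof
    fix y assume "y \<in> nbrs z"
    then have y: "z \<sim> y" by simp
    then have "y \<in> {w,w',v,v',q,z} \<or> y \<in> X" using mem adj_in_verts by blast
    then show "y \<in> {v,v',q}" using y nzw nzX by auto
  qed
  then have "card (nbrs z) \<le> card {v,v',q}" by (rule card_mono[rotated]) simp
  also have "\<dots> \<le> 3" by (simp add: card_insert_if)
  finally have zb: "z \<notin> big" using big_degree[of z] by linarith
  have "nbrs q \<subseteq> {w,w',z}"
  proof
    fix y assume "y \<in> nbrs q"
    then have y: "q \<sim> y" by simp
    then have "y \<in> {w,w',v,v',q,z} \<or> y \<in> X" using mem adj_in_verts by blast
    then show "y \<in> {w,w',z}" using y nqv nqX by auto
  qed
  moreover have "{w,w',z} \<subseteq> nbrs q" using wa wa' zq qq adj_sym by blast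
  ultimately have nbq: "nbrs q = {w,w',z}" by blast
  have cq: "card (nbrs q) = 3" unfolding nbq using ne wz by simp
  then have qb: "q \<notin> big" using big_degree[of q] by linarith
  \<comment> \<open>The far vertex in a triple has degree two; for \<open>y\<close> in
    \<open>X\<close> it would have to be \<open>q\<close>, whose degree is three.\<close>
  have Xb: "y \<notin> big" if y: "y \<in> X" for y
  proof
    assume "y \<in> big"
    then have "y \<in> bigs" using X[OF y] by (simp add: bigs_def)
    then obtain a b c where abc: "triple y a b c" using triple_exists by blast
    then have "a = q" using far_q[OF y, of a] triple_not_near by (auto simp: triple_def)
    then have "card (nbrs q) = 2" using abc by (simp add: triple_def)
    then show False using cq by simp
  qed
  have "big \<subseteq> {v,v'}"
  proof
    fix y assume y: "y \<in> big"
    then have "y \<in> {w,w',v,v',q,z} \<or> y \<in> X" using mem by (auto simp: big_def)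
    then show "y \<in> {v,v'}" using y Xb qb zb t triple_far_small by blast
  qed
  then have "card big \<le> card {v,v'}" by (rule card_mono[rotated]) simp
  also have "\<dots> \<le> 2" by (simp add: card_insert_if)
  finally show False using card_big order by linarith
qed

text \<open>A triple is the closed neighbourhood of its far vertex, so equal far vertices give equal
  triples; adjacent far vertices are handled by \<open>adjacent_far_agree\<close>. Otherwise
  \<open>v\<close> is adjacent to \<open>w'\<close> and \<open>v'\<close> to \<open>w\<close>, so
  each of \<open>v\<close>, \<open>v'\<close> lies in the triple of the other.\<close>

lemma triples_agree:
  assumes v: "v \<in> bigs" "v' \<in> bigs" and t: "triple v w p q" "triple v' w' p' q'"
  shows "{w,p,q} = {w',p',q'}"
proof (cases "w' \<in> {w,p,q}")
  case True
  show ?thesis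
  proof (cases "w = w'")
    case True
    then show ?thesis using t by (metis triple_def)
  next
    case False
    then have "w \<sim> w'" using True triple_far_adj[OF t(1)] by blast
    then have "w = p' \<or> w = q'" using triple_far_adj[OF t(2)] adj_sym by blast
    then obtain b where b: "triple v' w' w b" "{w',p',q'} = {w',w,b}"
      using t(2) triple_swap by blast
    obtain a where a: "triple v w w' a" "{w,p,q} = {w,w',a}"
      using t(1) True False triple_swap by blast
    show ?thesis using adjacent_far_agree[OF a(1) b(1)] a(2) b(2) by blast
  qed
next
  case False
  have "w \<notin> {w',p',q'}"
    using False triple_far_adj[OF t(1), of w'] triple_far_adj[OF t(2), of w] adj_sym by blast
  have "w' \<noteq> v" "w \<noteq> v'" using v t triple_far_small by (auto simp: bigs_def)
  have "v \<sim> w'"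
    using triple_adj[OF t(1), of w'] False \<open>w' \<noteq> v\<close> t(2) by (auto simp: triple_def)
  then have "v = p' \<or> v = q'" using triple_far_adj[OF t(2)] adj_sym by blast
  then obtain b where b: "triple v' w' v b" "b \<in> {p',q'}" using t(2) triple_swap by blast
  have "v' \<sim> w"
    using triple_adj[OF t(2), of w] \<open>w \<notin> _\<close> \<open>w \<noteq> v'\<close> t(1) by (auto simp: triple_def)
  then have "v' = p \<or> v' = q" using triple_far_adj[OF t(1)] adj_sym by blast
  then obtain a where a: "triple v w v' a" "a \<in> {p,q}" using t(1) triple_swap by blast
  have "w \<noteq> w'" "w' \<noteq> a" "w \<noteq> b" using False \<open>w \<notin> {w',p',q'}\<close> a b by blast+
  then show ?thesis using nonadjacent_far_impossible[OF v a(1) b(1)] by blast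
qed

end

text \<open>In the extremal graph, \<open>C\<close> is the set of clones of \<open>a\<close>, and \<open>x\<close>, \<open>y\<close>, \<open>w\<close> are the vertices
  subdividing \<open>ab\<close>, \<open>ca\<close>, \<open>bc\<close>.\<close>

definition clone_shape :: "'a pair_pre_digraph \<Rightarrow> 'a set \<Rightarrow> 'a \<Rightarrow> 'a \<Rightarrow> 'a \<Rightarrow> 'a \<Rightarrow> 'a \<Rightarrow> 'a \<Rightarrow> bool" where
  "clone_shape G C h b c x y w \<longleftrightarrow>
     pverts G = C \<union> {h,b,c,x,y,w} \<and> C \<inter> {h,b,c,x,y,w} = {} \<and> distinct [h,b,c,x,y,w]
     \<and> (\<forall>v\<in>C. parcs G `` {v} = C - {v} \<union> {h,x,y})
     \<and> parcs G `` {h} = C \<union> {b,c}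
     \<and> parcs G `` {b} = {h,x,w} \<and> parcs G `` {c} = {h,y,w}
     \<and> parcs G `` {x} = C \<union> {b} \<and> parcs G `` {y} = C \<union> {c}
     \<and> parcs G `` {w} = {b,c}"

context critical_graph begin

lemma bigs_nonempty: "bigs \<noteq> {}"
  using card_bigs(1) order by auto

text \<open>Agreement of the triples as sets suffices: the names \<open>w\<close>, \<open>p\<close>,
  \<open>q\<close> are taken from one vertex \<open>v0\<close> and describe the non-neighbours of
  all the others.\<close>

lemma common_far_set:
  "\<exists>w p q. (\<forall>v\<in>bigs. {v,w,p,q} \<subseteq> pverts G \<and> distinct [v,w,p,q] \<and> nbrs v = pverts G - {v,w,p,q})
    \<and> nbrs w = {p,q} \<and> w \<noteq> z"
proof -
  obtain v0 where v0: "v0 \<in> bigs" using bigs_nonempty by blast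
  obtain w p q where t: "triple v0 w p q" using triple_exists v0 by blast
  have "{v,w,p,q} \<subseteq> pverts G \<and> distinct [v,w,p,q] \<and> nbrs v = pverts G - {v,w,p,q}"
    if v: "v \<in> bigs" for v
  proof -
    obtain w' p' q' where t': "triple v w' p' q'" using triple_exists v by blast
    have eq: "{w,p,q} = {w',p',q'}" using triples_agree[OF v0 v t t'] .
    have "v \<notin> {w',p',q'}" "nbrs v = pverts G - insert v {w',p',q'}"
      using t' by (simp_all add: triple_def)
    then have "v \<notin> {w,p,q}" "nbrs v = pverts G - insert v {w,p,q}" unfolding eq by blast+
    then show ?thesis using t v by (simp add: triple_def bigs_iff)
  qed
  moreover have "nbrs w = {p,q}" using t by (simp add: triple_def)
  ultimately show ?thesis using triple_far_not_center[OF t] by metis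
qed

end

section \<open>Structure of the graph when all vertices of \<open>bigs\<close> share one
  triple\<close>

locale common_triple = critical_graph +
  fixes w p q
  assumes bigs_triple: "v \<in> bigs \<Longrightarrow> {v,w,p,q} \<subseteq> pverts G \<and> distinct [v,w,p,q] \<and> nbrs v = pverts G - {v,w,p,q}"
    and nbrs_w: "nbrs w = {p,q}"
    and w_not_z: "w \<noteq> z"
begin

text \<open>Transfers every fact about \<open>p\<close> to \<open>q\<close>.\<close>

lemma swap: "common_triple G z w q p"
  using bigs_triple nbrs_w w_not_z
  by unfold_locales (auto simp: insert_commute)

text \<open>In the end this is \<open>z\<close> together with the two subdividing vertices adjacent
  to the clones.\<close>

definition rest :: "'a set" where
  "rest = pverts G - bigs - {w,p,q}"

lemma wpq: "{w,p,q} \<subseteq> pverts G" "distinct [w,p,q]" "v \<in> bigs \<Longrightarrow> v \<notin> {w,p,q}"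
  using bigs_triple bigs_nonempty by fastforce+

lemma bigs_adj: "v \<in> bigs \<Longrightarrow> v \<sim> x \<longleftrightarrow> x \<in> pverts G \<and> x \<notin> {v,w,p,q}"
  using bigs_triple by blast

lemma w_adj: "w \<sim> x \<longleftrightarrow> x = p \<or> x = q"
  using nbrs_w by blast

lemma verts_cases:
  assumes "x \<in> pverts G" obtains "x \<in> bigs" | "x = w" | "x = p" | "x = q" | "x \<in> rest"
  using assms by (auto simp: rest_def)

lemma rest_adj: "v \<in> bigs \<Longrightarrow> x \<in> rest \<Longrightarrow> v \<sim> x \<and> x \<sim> v"
  using bigs_adj adj_sym by (auto simp: rest_def)

lemma rest_notin: "x \<in> rest \<Longrightarrow> x \<in> pverts G \<and> x \<noteq> w \<and> x \<noteq> p \<and> x \<noteq> q \<and> x \<notin> bigs"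
  by (auto simp: rest_def)

lemma bigs_nonadj: "v \<in> bigs \<Longrightarrow> \<not> v \<sim> w \<and> \<not> v \<sim> p \<and> \<not> v \<sim> q \<and> \<not> w \<sim> v \<and> \<not> p \<sim> v \<and> \<not> q \<sim> v"
  using bigs_adj adj_sym by blast

lemma card_verts: "card (pverts G) = card bigs + card rest + 3"
proof -
  have "card rest = card (pverts G) - card bigs - 3"
    unfolding rest_def using wpq finite_big bigs_iff
    by (subst card_Diff_subset, simp, fastforce, subst card_Diff_subset) auto
  moreover have "card (bigs \<union> {w,p,q}) \<le> card (pverts G)"
    by (rule card_mono[OF pair_finite_verts]) (use wpq bigs_iff in auto)
  moreover have "card (bigs \<union> {w,p,q}) = card bigs + 3"
    using wpq finite_big by (subst card_Un_disjoint) auto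
  ultimately show ?thesis by linarith
qed

text \<open>Since n = |bigs| + |rest| + 3 and |bigs| is at least n - 6, or n - 5 if \<open>z\<close>
  is not big.\<close>

lemma card_rest: "card rest \<le> 3" "card rest = 3 \<Longrightarrow> z \<in> big"
  using card_bigs card_verts order by linarith+

text \<open>Vertices of \<open>rest\<close> are adjacent to all of \<open>bigs\<close>, hence within
  distance two of each other, so a far vertex must belong to the triple.\<close>

lemma rest_far:
  assumes "r \<in> rest" "r \<noteq> z"
  shows "\<exists>y\<in>{w,p,q}. \<not> near r y"
proof -
  obtain v where v: "v \<in> bigs" using bigs_nonempty by blast
  obtain y where y: "y \<in> pverts G" "\<not> near r y" using not_near rest_notin assms by blast
  have "y \<notin> bigs" using y rest_adj assms near_iff by blast
  moreover have "y \<notin> rest" using y rest_adj[OF v] assms near_iff by blast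
  ultimately show ?thesis using y by (auto simp: rest_def)
qed

text \<open>If \<open>z = p\<close>, each vertex of \<open>rest\<close> is far from \<open>w\<close>
  or \<open>q\<close>, hence not adjacent to \<open>q\<close>. A path from \<open>p\<close> to
  \<open>bigs\<close> uses some \<open>r\<close> in \<open>rest\<close>, which reaches
  \<open>w\<close> through \<open>p\<close> and so is far from \<open>q\<close>; thus
  \<open>pq\<close> is no edge, and \<open>q\<close> is a leaf hanging at \<open>w\<close> instead
  of \<open>z\<close>.\<close>

lemma center_not_p: "z \<noteq> p"
proof
  assume zp: "z = p"
  obtain v where v: "v \<in> bigs" using bigs_nonempty by blast
  have wp: "w \<sim> p" "p \<sim> w" "w \<sim> q" "q \<sim> w" using w_adj adj_sym by blast+
  have far: "\<not> near r w \<or> \<not> near r q" if "r \<in> rest" for r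
  proof -
    have "near r p" using z_near[of r] rest_notin[OF that] zp near_sym by blast
    then show ?thesis using rest_far[OF that] rest_notin[OF that] zp by blast
  qed
  have "near p v" using z_near v zp bigs_iff by blast
  then obtain r where r: "p \<sim> r" "r \<sim> v" using bigs_nonadj[OF v] wpq(3)[OF v] unfolding near_iff by blast
  have "r \<in> pverts G" using r adj_in_verts by blast
  then have "r \<in> rest"
    by (cases rule: verts_cases) (use r bigs_nonadj v bigs_nonadj in auto)
  then have "\<not> near r q" using far r wp unfolding near_iff using adj_sym by blast
  then have npq: "\<not> p \<sim> q" using r near_iff adj_sym by blast
  have "\<not> q \<sim> s" if "s \<in> rest" for s
    using far[OF that] wp unfolding near_iff using adj_sym by blast
  then have "q \<sim> x \<Longrightarrow> x = w" for x
    using adj_in_verts[of q x] bigs_nonadj npq adj_sym by (metis adj_irrefl verts_cases)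
  then have "nbrs q = {w}" using wp by blast
  then show False using leaf_at_center[of q w] w_not_z zp wpq(2) by auto
qed

lemma center_in_rest: "z \<in> rest"
  using center_not_p common_triple.center_not_p[OF swap] w_not_z z_vert bigs_iff
  by (auto simp: rest_def)

text \<open>Through \<open>z\<close> the vertex \<open>p\<close> reaches all of \<open>bigs\<close>,
  and through \<open>w\<close> it reaches \<open>q\<close>; its far vertex can only lie in
  \<open>rest\<close>.\<close>

lemma p_far:
  assumes zp: "z \<sim> p"
  shows "\<exists>r\<in>rest. r \<noteq> z \<and> \<not> near p r"
proof -
  obtain y where y: "y \<in> pverts G" "\<not> near p y" using not_near[of p] center_not_p wpq by auto
  have "y \<notin> bigs" using y zp rest_adj[OF _ center_in_rest] unfolding near_iff using adj_sym by blast
  moreover have "y \<noteq> w" "y \<noteq> q" "y \<noteq> p" using y w_adj unfolding near_iff using adj_sym by blast+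
  moreover have "y \<noteq> z" using y zp near_iff adj_sym by blast
  ultimately show ?thesis using y by (auto simp: rest_def)
qed

text \<open>A walk of length at most three from \<open>w\<close> to \<open>r\<close> starts with
  \<open>p\<close> or \<open>q\<close>.\<close>

lemma near_other:
  assumes r: "r \<in> rest" "\<not> near p r"
  shows "near q r"
proof -
  have "walk_le (parcs G) 3 w r" using diam_three wpq rest_notin r by blast
  then obtain x where "w \<sim> x" "near x r"
    using rest_notin[OF r(1)] unfolding walk_le_three_iff by blast
  then show ?thesis using w_adj[of x] r(2) by blast
qed

text \<open>A common neighbour of \<open>z\<close> and \<open>q\<close> in \<open>rest\<close> would
  be near the whole triple, so without the edge \<open>zq\<close> the center reaches
  \<open>q\<close> through \<open>p\<close>. Then \<open>q\<close> reaches \<open>r\<close> only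
  through a third vertex \<open>s\<close> of \<open>rest\<close>, and counting the degree of
  \<open>z\<close> makes \<open>s\<close> such a forbidden common neighbour.\<close>

lemma center_adj_q:
  assumes zp: "z \<sim> p"
  shows "z \<sim> q"
proof (rule ccontr)
  assume nzq: "\<not> z \<sim> q"
  obtain r where r: "r \<in> rest" "r \<noteq> z" "\<not> near p r" using p_far zp by blast
  have wp: "w \<sim> p" "p \<sim> w" "w \<sim> q" "q \<sim> w" using w_adj adj_sym by blast+
  have zr: "\<not> z \<sim> r" using zp r near_iff adj_sym by blast
  have no: False if y: "y \<in> rest" "y \<noteq> z" "z \<sim> y" "y \<sim> q" for y
    using rest_far[OF y(1,2)] y wp zp unfolding near_iff using adj_sym by blast
  have zw: "\<not> z \<sim> w" using w_adj adj_sym center_not_p common_triple.center_not_p[OF swap] by blast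
  have "near z q" using z_near wpq by auto
  then obtain y where y: "z \<sim> y" "y \<sim> q" using nzq center_in_rest rest_notin unfolding near_iff by metis
  have "y \<in> pverts G" "y \<noteq> z" using y adj_in_verts by auto
  from this(1) have "y = p"
    by (cases rule: verts_cases) (use y bigs_nonadj zw no \<open>y \<noteq> z\<close> in auto)
  then have pq: "p \<sim> q" using y by blast
  have qr: "\<not> q \<sim> r" using pq r near_iff by blast
  have "near q r" using near_other r by blast
  then obtain s where s: "q \<sim> s" "s \<sim> r" using qr r rest_notin unfolding near_iff by metis
  have "s \<in> pverts G" using s adj_in_verts by blast
  then have sR: "s \<in> rest"
    by (cases rule: verts_cases) (use s bigs_nonadj wp r near_iff in auto)
  have d: "s \<noteq> z" "s \<noteq> r" using s zr by auto
  have fin: "finite rest" using pair_finite_verts by (simp add: rest_def)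
  have sub: "{z,r,s} \<subseteq> rest" using center_in_rest r sR by blast
  have "card {z,r,s} = 3" using d r by auto
  then have R: "rest = {z,r,s}" and c3: "card rest = 3"
    using card_rest(1) card_mono[OF fin sub] card_seteq[OF fin sub] by auto
  \<comment> \<open>With three vertices in \<open>rest\<close>, \<open>z\<close> is big and has
    degree |bigs| + 2, whereas \<open>bigs\<close> and \<open>p\<close> alone supply at most |bigs|
    + 1 neighbours.\<close>
  have "z \<sim> s"
  proof (rule ccontr)
    assume zs: "\<not> z \<sim> s"
    have "nbrs z \<subseteq> bigs \<union> {p}"
    proof
      fix x assume "x \<in> nbrs z"
      then have x: "z \<sim> x" by simp
      then have "x \<in> pverts G" using adj_in_verts by blast
      then show "x \<in> bigs \<union> {p}"
        by (cases rule: verts_cases) (use x zs zr zw nzq R in auto)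
    qed
    then have "card (nbrs z) \<le> card (bigs \<union> {p})" by (rule card_mono[rotated]) (simp add: finite_big)
    also have "\<dots> \<le> card bigs + 1" using finite_big by (simp add: card_insert_if)
    finally show False using card_rest(2)[OF c3] card_verts c3 by (simp add: big_def)
  qed
  then show False using no[OF sR d(1)] s adj_sym by blast
qed

lemma center_adj: "z \<sim> p" "z \<sim> q"
proof -
  interpret sw: common_triple G z w q p by (rule swap)
  have "near z w" using z_near wpq by auto
  then have "z \<sim> p \<or> z \<sim> q"
    using w_not_z w_adj center_not_p sw.center_not_p unfolding near_iff using adj_sym by metis
  then show "z \<sim> p" "z \<sim> q" using center_adj_q sw.center_adj_q by blast+
qed

text \<open>By \<open>near_other\<close> no vertex of \<open>rest\<close> is far from both
  \<open>p\<close> and \<open>q\<close>, so the vertices \<open>r\<close> and \<open>s\<close> far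
  from them are distinct and, with \<open>z\<close>, exhaust \<open>rest\<close>. The far pairs then
  decide every remaining adjacency, with \<open>s\<close> as \<open>x\<close> and \<open>r\<close>
  as \<open>y\<close>.\<close>

lemma shape: "\<exists>x y. clone_shape G bigs z p q x y w"
proof -
  interpret sw: common_triple G z w q p by (rule swap)
  have rest_sw: "sw.rest = rest" by (auto simp: rest_def sw.rest_def)
  obtain r where r: "r \<in> rest" "r \<noteq> z" "\<not> near p r" using p_far center_adj by blast
  obtain s where s: "s \<in> rest" "s \<noteq> z" "\<not> near q s" using sw.p_far center_adj rest_sw by blast
  have qr: "near q r" using near_other r by blast
  have ps: "near p s" using sw.near_other s rest_sw by blast
  have rs: "r \<noteq> s" using qr s by blast
  have fin: "finite rest" using pair_finite_verts by (simp add: rest_def)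
  have sub: "{z,r,s} \<subseteq> rest" using center_in_rest r s by blast
  have "card {z,r,s} = 3" using rs r s by auto
  then have R: "rest = {z,r,s}" 
    using card_rest(1) card_mono[OF fin sub] card_seteq[OF fin sub] by auto
  note zz = center_adj
  have wp: "w \<sim> p" "p \<sim> w" "w \<sim> q" "q \<sim> w" using w_adj adj_sym by blast+
  have nz: "\<not> z \<sim> r" "\<not> z \<sim> s" using zz r s near_iff adj_sym by blast+
  have npr: "\<not> p \<sim> r" and nqs: "\<not> q \<sim> s" using r s near_iff by blast+
  have cases: "x \<in> bigs \<or> x \<in> {w,p,q,z,r,s}" if "x \<in> pverts G" for x
    using that R by (cases rule: verts_cases) auto
  have adj_cases: "y \<in> bigs \<or> y \<in> {w,p,q,z,r,s}" if "x \<sim> y" for x y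
    using cases adj_in_verts that by blast
  \<comment> \<open>Since \<open>r\<close> is within distance two of \<open>q\<close>, it suffices
    to exclude every possible common neighbour.\<close>
  have q_r: "q \<sim> r"
  proof (rule ccontr)
    assume n: "\<not> q \<sim> r"
    then obtain t where t: "q \<sim> t" "t \<sim> r" using qr r rest_notin unfolding near_iff by metis
    then have "t \<noteq> w" "t \<noteq> p" "t \<noteq> z" "t \<noteq> s" "t \<noteq> q" "t \<noteq> r" "t \<notin> bigs"
      using w_adj rest_notin[OF r(1)] r nz nqs near_iff n bigs_nonadj by auto
    then show False using adj_cases t by blast
  qed
  have p_s: "p \<sim> s"
  proof (rule ccontr)
    assume n: "\<not> p \<sim> s"
    then obtain t where t: "p \<sim> t" "t \<sim> s" using ps s rest_notin unfolding near_iff by metis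
    then have "t \<noteq> w" "t \<noteq> q" "t \<noteq> z" "t \<noteq> r" "t \<noteq> p" "t \<noteq> s" "t \<notin> bigs"
      using w_adj rest_notin[OF s(1)] s nz npr near_iff n bigs_nonadj by auto
    then show False using adj_cases t by blast
  qed
  \<comment> \<open>An edge \<open>pq\<close>, or below an edge \<open>rs\<close>, would bring
    \<open>p\<close> within distance two of \<open>r\<close>.\<close>
  have npq: "\<not> p \<sim> q" using q_r r near_iff by blast
  have nrs: "\<not> r \<sim> s" using p_s r near_iff adj_sym by blast
  have nw: "\<not> w \<sim> z" "\<not> w \<sim> r" "\<not> w \<sim> s" using w_adj R rest_notin by auto
  have sy: "\<not> r \<sim> z" "\<not> s \<sim> z" "\<not> r \<sim> p" "\<not> s \<sim> q" "\<not> q \<sim> p" "\<not> s \<sim> r" "\<not> z \<sim> w" "\<not> r \<sim> w" "\<not> s \<sim> w"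
    "r \<sim> q" "s \<sim> p" "p \<sim> z" "q \<sim> z"
    using nz npr nqs npq nrs nw q_r p_s zz adj_sym by blast+
  have bz: "z \<sim> v" "r \<sim> v" "s \<sim> v" if "v \<in> bigs" for v
    using rest_adj that R by blast+
  have V: "pverts G = bigs \<union> {z,p,q,s,r,w}"
  proof
    show "pverts G \<subseteq> bigs \<union> {z,p,q,s,r,w}" using cases by blast
    show "bigs \<union> {z,p,q,s,r,w} \<subseteq> pverts G"
      using wpq(1) r(1) s(1) z_vert rest_notin by (auto simp: bigs_iff)
  qed
  have D: "bigs \<inter> {z,p,q,s,r,w} = {}" using wpq(3) R rest_notin by blast
  have dist: "distinct [z,p,q,s,r,w]" using wpq(2) R rest_notin r s rs by auto
  have "parcs G `` {v} = bigs - {v} \<union> {z,s,r}" if v: "v \<in> bigs" for v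
  proof -
    have "nbrs v = pverts G - {v,w,p,q}" using bigs_triple[OF v] by blast
    then show ?thesis unfolding V using D dist v by auto
  qed
  moreover have "z \<sim> x \<longleftrightarrow> x \<in> bigs \<or> x = p \<or> x = q" for x
    using adj_cases[of z x] zz nz sy bz by auto
  then have "parcs G `` {z} = bigs \<union> {p,q}" by blast
  moreover have "p \<sim> x \<longleftrightarrow> x = z \<or> x = s \<or> x = w" for x
    using adj_cases[of p x] wp npr npq p_s sy bigs_nonadj by auto
  then have "parcs G `` {p} = {z,s,w}" by blast
  moreover have "q \<sim> x \<longleftrightarrow> x = z \<or> x = r \<or> x = w" for x
    using adj_cases[of q x] wp nqs sy q_r bigs_nonadj by auto
  then have "parcs G `` {q} = {z,r,w}" by blast
  moreover have "s \<sim> x \<longleftrightarrow> x \<in> bigs \<or> x = p" for x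
    using adj_cases[of s x] sy bz by auto
  then have "parcs G `` {s} = bigs \<union> {p}" by blast
  moreover have "r \<sim> x \<longleftrightarrow> x \<in> bigs \<or> x = q" for x
    using adj_cases[of r x] sy bz nrs by auto
  then have "parcs G `` {r} = bigs \<union> {q}" by blast
  ultimately have "clone_shape G bigs z p q s r w"
    unfolding clone_shape_def using V D dist nbrs_w by auto
  then show ?thesis by blast
qed

end

lemma (in critical_graph) clone_shape_exists: "\<exists>C h b c x y w. clone_shape G C h b c x y w"
proof -
  obtain w p q where "common_triple G z w p q"
  proof -
    obtain w p q where A: "\<forall>v\<in>bigs. {v,w,p,q} \<subseteq> pverts G \<and> distinct [v,w,p,q] \<and> nbrs v = pverts G - {v,w,p,q}"
      "nbrs w = {p,q}" "w \<noteq> z" using common_far_set by (elim exE conjE) (rule that)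
    have "common_triple G z w p q"
      by (intro common_triple.intro critical_graph_axioms common_triple_axioms.intro bspec[OF A(1)] A(2,3))
    then show thesis by (rule that)
  qed
  then show ?thesis using common_triple.shape[of G z w p q] by blast
qed

section \<open>Reduction to diameter three\<close>

context pair_graph begin

lemma awalk_imp_walk_le:
  "awalk u p v \<Longrightarrow> length p \<le> k \<Longrightarrow> walk_le (parcs G) k u v"
proof (induction p arbitrary: u k)
  case Nil
  then show ?case by (cases k) (auto simp: awalk_Nil_iff)
next
  case (Cons e p)
  then show ?case by (cases k; cases e) (auto simp: awalk_Cons_iff)
qed

lemma walk_le_imp_awalk:
  "walk_le (parcs G) k u v \<Longrightarrow> u \<in> pverts G \<Longrightarrow> \<exists>p. awalk u p v \<and> length p \<le> k"
proof (induction k arbitrary: u)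
  case 0
  then show ?case by (auto simp: awalk_Nil_iff)
next
  case (Suc k)
  show ?case
  proof (cases "u = v")
    case True
    then show ?thesis using Suc.prems by (intro exI[of _ "[]"]) (auto simp: awalk_Nil_iff)
  next
    case False
    then obtain x where x: "u \<sim> x" "walk_le (parcs G) k x v" using Suc.prems by auto
    then obtain p where "awalk x p v" "length p \<le> k" using Suc.IH adj_in_verts by blast
    then show ?thesis using x by (intro exI[of _ "(u,x) # p"]) (auto simp: awalk_Cons_iff)
  qed
qed

lemma awalk_cost_unit: "awalk_cost (\<lambda>_. 1) p = real (length p)"
  by (induction p) auto

text \<open>An infimum strictly below \<open>k + 1\<close> yields a walk of cost below
  \<open>k + 1\<close>; costs are integral lengths, so the length is at most
  \<open>k\<close>.\<close>

lemma walk_le_if_vertex_dist_less: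
  assumes "vertex_dist (with_proj G) u v < ereal (real (Suc k))"
  shows "walk_le (parcs G) k u v"
proof -
  obtain p where "awalk u p v" "ereal (awalk_cost (\<lambda>_. 1) p) < ereal (real (Suc k))"
    using assms unfolding vertex_dist_def \<mu>_def INF_less_iff by auto
  then show ?thesis by (intro awalk_imp_walk_le) (auto simp: awalk_cost_unit)
qed

lemma vertex_dist_le_if_walk_le:
  assumes "walk_le (parcs G) k u v" "u \<in> pverts G"
  shows "vertex_dist (with_proj G) u v \<le> ereal (real k)"
proof -
  obtain p where p: "awalk u p v" "length p \<le> k" using walk_le_imp_awalk assms by blast
  have "vertex_dist (with_proj G) u v \<le> ereal (awalk_cost (\<lambda>_. 1) p)"
    unfolding vertex_dist_def by (rule min_cost_le_walk_cost[OF p(1)])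
  also have "\<dots> \<le> ereal (real k)" using p(2) by (simp add: awalk_cost_unit)
  finally show ?thesis .
qed

lemma eccentricity_less_imp:
  assumes "eccentricity (with_proj G) v < ereal (real (Suc k))" "u \<in> pverts G"
  shows "walk_le (parcs G) k v u"
proof -
  have "vertex_dist (with_proj G) v u \<le> eccentricity (with_proj G) v"
    unfolding eccentricity_def using assms(2) pair_finite_verts by (intro Max_ge) auto
  then show ?thesis using assms(1) walk_le_if_vertex_dist_less by simp
qed

lemma eccentricity_le:
  assumes "v \<in> pverts G" "\<And>u. u \<in> pverts G \<Longrightarrow> walk_le (parcs G) k v u"
  shows "eccentricity (with_proj G) v \<le> ereal (real k)"
  unfolding eccentricity_def using assms pair_finite_verts vertex_dist_le_if_walk_le
  by (intro Max.boundedI) auto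

lemma out_degree_eq: "out_degree (with_proj G) v = card (nbrs v)"
proof -
  have "out_arcs (with_proj G) v = Pair v ` nbrs v" by (auto simp: out_arcs_def)
  then show ?thesis unfolding out_degree_def by (simp add: card_image inj_on_def)
qed

section \<open>Excluding diameters other than three\<close>

lemma connected_crossing:
  assumes "connected (with_proj G)" "A \<subseteq> pverts G" "A \<noteq> {}" "A \<noteq> pverts G"
  shows "\<exists>a\<in>A. \<exists>b\<in>pverts G - A. a \<sim> b"
proof (rule ccontr)
  assume no: "\<not> ?thesis"
  obtain a b where ab: "a \<in> A" "b \<in> pverts G - A" using assms by blast
  have "strongly_connected (with_proj G)"
    using symmetric_connected_imp_strongly_connected assms(1) sym_arcs by blast
  then have "a \<rightarrow>\<^sup>*\<^bsub>with_proj G\<^esub> b" using ab assms(2) by (auto simp: strongly_connected_def)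
  then obtain p where "awalk a p b" by (auto simp: reachable_awalk)
  \<comment> \<open>Without a crossing edge \<open>A\<close> is closed under adjacency, so the walk
    never leaves it.\<close>
  then have "b \<in> A" using ab(1)
  proof (induction p arbitrary: a)
    case Nil
    then show ?case by (simp add: awalk_Nil_iff)
  next
    case (Cons e p)
    obtain x where e: "e = (a, x)" "a \<sim> x" "awalk x p b"
      using Cons.prems by (cases e) (auto simp: awalk_Cons_iff)
    then have "x \<in> A" using no Cons.prems adj_in_verts by blast
    then show ?case using Cons.IH e by blast
  qed
  then show False using ab by blast
qed

text \<open>There is a path \<open>v u p q y\<close> such that \<open>p\<close>, \<open>q\<close>, \<open>y\<close> are alone at distance two, three, four from \<open>v\<close>;
  then \<open>u\<close> and \<open>p\<close> are within distance three of everything.\<close>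

lemma two_vertices_within_three:
  assumes conn: "connected (with_proj G)"
    and v: "v \<in> pverts G" "card (pverts G - {v} - nbrs v) = 3"
    and y: "y \<in> pverts G" "\<not> walk_le (parcs G) 3 v y"
  shows "\<exists>u p. u \<in> pverts G \<and> p \<in> pverts G \<and> u \<noteq> p
     \<and> (\<forall>x\<in>pverts G. walk_le (parcs G) 3 u x) \<and> (\<forall>x\<in>pverts G. walk_le (parcs G) 3 p x)"
proof -
  define T where "T = pverts G - {v} - nbrs v"
  have walk3: "a \<sim> b \<Longrightarrow> near b c \<Longrightarrow> walk_le (parcs G) 3 a c" for a b c
    unfolding walk_le_three_iff by blast
  have near3: "near a c \<Longrightarrow> walk_le (parcs G) 3 a c" for a c
    unfolding walk_le_three_iff near_iff by blast
  have yT: "y \<in> T" and ny: "\<not> near v y"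
    using y near3 unfolding T_def near_iff by auto
  have V: "x = v \<or> v \<sim> x \<or> x \<in> T" if "x \<in> pverts G" for x using that by (auto simp: T_def)
  obtain u p where up: "u \<in> insert v (nbrs v)" "p \<in> pverts G - insert v (nbrs v)" "u \<sim> p"
    using connected_crossing[OF conn, of "insert v (nbrs v)"] v yT nbrs_subset by (auto simp: T_def)
  have vu: "v \<sim> u" "p \<in> T" using up by (auto simp: T_def)
  have py: "p \<noteq> y" using ny vu up near_iff by blast
  obtain a q where q: "a \<in> insert p (insert v (nbrs v))" "q \<in> pverts G - insert p (insert v (nbrs v))" "a \<sim> q"
  proof -
    have "insert p (insert v (nbrs v)) \<subseteq> pverts G" "insert p (insert v (nbrs v)) \<noteq> pverts G"
      using v up nbrs_subset[of v] yT py by (auto simp: T_def)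
    then show thesis using connected_crossing[OF conn, of "insert p (insert v (nbrs v))"] that by blast
  qed
  have qT: "q \<in> T" "q \<noteq> p" using q by (auto simp: T_def)
  have near_p: "near v p" using vu up near_iff by blast
  have npy: "\<not> p \<sim> y"
    using y(2) vu up walk3[of v u y] near_iff by blast
  have nNy: "\<not> x \<sim> y" if "v \<sim> x" for x using that ny near_iff by blast
  have qy: "q \<noteq> y" using q npy nNy ny near_iff by blast
  have "T = {p,q,y}"
  proof -
    have "finite T" "{p,q,y} \<subseteq> T" "card {p,q,y} = 3"
      using pair_finite_verts vu qT yT py qy by (auto simp: T_def)
    then show ?thesis using v(2) card_seteq[of T "{p,q,y}"] T_def by simp
  qed
  then have V: "x = v \<or> v \<sim> x \<or> x = p \<or> x = q \<or> x = y" if "x \<in> pverts G" for x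
    using V that by blast
  obtain c where c: "c \<in> pverts G" "c \<noteq> y" "c \<sim> y"
    using connected_crossing[OF conn, of "{y}"] y v adj_sym near_iff ny by blast
  then have "c = q" using V[of c] npy nNy ny near_iff by blast
  then have qy': "q \<sim> y" using c by blast
  \<comment> \<open>Otherwise \<open>v\<close> would reach \<open>y\<close> through \<open>q\<close>
    in at most three steps; hence the edge entering \<open>q\<close> starts at
    \<open>p\<close>.\<close>
  have "\<not> v \<sim> q" "\<not> (v \<sim> x \<and> x \<sim> q)" for x
    using qy' y(2) walk3[of v x y] nNy near_iff by blast+
  then have pq: "p \<sim> q" using q by blast
  have "walk_le (parcs G) 3 u x" if "x \<in> pverts G" for x
    using V[OF that] vu up pq qy' walk3[of u p x] near3[of u x] adj_sym unfolding near_iff by metis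
  moreover have "walk_le (parcs G) 3 p x" if "x \<in> pverts G" for x
    using V[OF that] vu up pq qy' walk3[of p u x] near3[of p x] adj_sym unfolding near_iff by metis
  moreover have "u \<noteq> p" using up by auto
  moreover have "u \<in> pverts G" "p \<in> pverts G" using up adj_in_verts by blast+
  ultimately show ?thesis by blast
qed

end

text \<open>Assuming only at least \<open>n - 5\<close> vertices of degree \<open>n - 4\<close> lets
  the result serve both the upper bound and uniqueness.\<close>

lemma critical_graph_exists:
  assumes n: "n \<ge> 8" and ap: "ap_graph n (n - 4) G"
    and many: "n - 5 \<le> card (verts_of_degree (with_proj G) (n - 4))"
  shows "\<exists>z. critical_graph G z"
proof -
  interpret pair_graph G using ap by (simp add: ap_graph_def)
  let ?D = "graph_diameter (with_proj G)" and ?ecc = "eccentricity (with_proj G)"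
  have cV: "card (pverts G) = n" and conn: "connected (with_proj G)"
    and per: "card (peripheral_verts (with_proj G)) = n - 1"
    and md: "max_degree (with_proj G) = n - 4"
    using ap by (auto simp: ap_graph_def almost_peripheral_def)
  have bigs: "verts_of_degree (with_proj G) (n - 4) = {v \<in> pverts G. card (nbrs v) = n - 4}"
    by (simp add: verts_of_degree_def out_degree_eq)
  have deg: "card (nbrs v) \<le> n - 4" if "v \<in> pverts G" for v
  proof -
    have "out_degree (with_proj G) v \<le> max_degree (with_proj G)"
      unfolding max_degree_def using that pair_finite_verts by (intro Max_ge) auto
    then show ?thesis using md by (simp add: out_degree_eq)
  qed
  have P: "peripheral_verts (with_proj G) \<subseteq> pverts G" by (auto simp: peripheral_verts_def)
  have "card (pverts G - peripheral_verts (with_proj G)) = 1"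
    using card_Diff_subset[OF finite_subset[OF P pair_finite_verts] P] cV per n by simp
  then obtain z where z: "pverts G - peripheral_verts (with_proj G) = {z}"
    using card_1_singletonE by blast
  have zV: "z \<in> pverts G" using z by blast
  have eccD: "?ecc v \<le> ?D" if "v \<in> pverts G" for v
    unfolding graph_diameter_def using that pair_finite_verts by (intro Max_ge) auto
  have eccz: "?ecc z < ?D"
    using eccD[OF zV] z zV by (auto simp: peripheral_verts_def less_le)
  have ecc: "?ecc v = ?D" if "v \<in> pverts G" "v \<noteq> z" for v
    using that z by (auto simp: peripheral_verts_def)
  \<comment> \<open>The eccentricity of \<open>z\<close> is strictly smaller than the diameter, so
    here \<open>z\<close> would be universal, with degree n - 1 > n - 4.\<close>
  have D2: "\<not> ?D \<le> ereal (real 2)"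
  proof
    assume "?D \<le> ereal (real 2)"
    then have "?ecc z < ereal (real (Suc 1))" using eccz by (simp add: numeral_2_eq_2)
    then have "walk_le (parcs G) 1 z u" if "u \<in> pverts G" for u
      using eccentricity_less_imp that by blast
    then have "pverts G - {z} \<subseteq> nbrs z" by auto
    then have "card (pverts G - {z}) \<le> card (nbrs z)" by (rule card_mono[OF finite_nbrs])
    then show False using deg[OF zV] zV cV n by simp
  qed
  have far: "\<exists>w\<in>pverts G. \<not> near v w" if "v \<in> pverts G" "v \<noteq> z" for v
    using eccentricity_le[of v 2] ecc[OF that] D2 that by metis
  have D3: "?D \<le> ereal (real 3)"
  proof (rule ccontr)
    assume D3: "\<not> ?D \<le> ereal (real 3)"
    have far3: "\<exists>w\<in>pverts G. \<not> walk_le (parcs G) 3 v w" if "v \<in> pverts G" "v \<noteq> z" for v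
      using eccentricity_le[of v 3] ecc[OF that] D3 that by metis
    \<comment> \<open>Because n - 5 > 1, some vertex of degree \<open>n - 4\<close> differs from
      \<open>z\<close>.\<close>
    have "\<not> {v \<in> pverts G. card (nbrs v) = n - 4} \<subseteq> {z}"
      using card_mono[of "{z}" "{v \<in> pverts G. card (nbrs v) = n - 4}"] many n bigs by auto
    then obtain v where v: "v \<in> pverts G" "card (nbrs v) = n - 4" "v \<noteq> z" by blast
    obtain y where "y \<in> pverts G" "\<not> walk_le (parcs G) 3 v y" using far3 v by blast
    moreover have "card (pverts G - {v} - nbrs v) = 3" using card_non_nbrs[OF v(1)] v(2) cV n by linarith
    ultimately show False using two_vertices_within_three[OF conn v(1)] far3 by metis
  qed
  have "critical_graph G z"
  proof unfold_locales
    show "8 \<le> card (pverts G)" "z \<in> pverts G" using n cV zV by auto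
    show "near z v" if "v \<in> pverts G" for v
    proof (rule eccentricity_less_imp[OF _ that])
      show "?ecc z < ereal (real (Suc 2))" using eccz D3 by (simp add: numeral_3_eq_3)
    qed
    show "\<exists>w\<in>pverts G. \<not> near v w" if "v \<in> pverts G" "v \<noteq> z" for v using far that by blast
    show "walk_le (parcs G) 3 u v" if "u \<in> pverts G" "v \<in> pverts G" for u v
    proof (rule eccentricity_less_imp[OF _ that(2)])
      have "?ecc u \<le> ereal (real 3)" using eccD[OF that(1)] D3 by (rule order_trans)
      also have "\<dots> < ereal (real (Suc 3))" by simp
      finally show "?ecc u < ereal (real (Suc 3))" .
    qed
    show "card (pverts G) - 5 \<le> card {v \<in> pverts G. card (nbrs v) = card (pverts G) - 4}"
      using many bigs cV by simp
  qed
  then show ?thesis by blast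
qed

section \<open>The extremal graph\<close>

context pair_graph begin

lemma connectedI_walk_le:
  assumes "pverts G \<noteq> {}" "\<And>u v. u \<in> pverts G \<Longrightarrow> v \<in> pverts G \<Longrightarrow> walk_le (parcs G) k u v"
  shows "connected (with_proj G)"
proof -
  have "(u, v) \<in> rtrancl_on (pverts G) (parcs G)" if uv: "u \<in> pverts G" "v \<in> pverts G" for u v
  proof -
    obtain p where "awalk u p v" using walk_le_imp_awalk assms(2) uv by blast
    then have "u \<rightarrow>\<^sup>*\<^bsub>with_proj G\<^esub> v" by (auto simp: reachable_awalk)
    then show ?thesis by (simp add: reachable_def)
  qed
  moreover have "parcs G \<subseteq> (parcs G)\<^sup>s" by (auto simp: symcl_def)
  ultimately show ?thesis using assms(1) unfolding connected_conv
    by (auto intro: rtrancl_on_mono)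
qed

end

section \<open>Degrees and distances in a graph of the extremal shape\<close>

locale clone_shaped = pair_graph +
  fixes C h b c x y w
  assumes shape: "clone_shape G C h b c x y w"
begin

lemma verts: "pverts G = C \<union> {h,b,c,x,y,w}"
  and disj: "C \<inter> {h,b,c,x,y,w} = {}"
  and dist: "distinct [h,b,c,x,y,w]"
  and nbrs_clone: "v \<in> C \<Longrightarrow> nbrs v = C - {v} \<union> {h,x,y}"
  and nbrs_h: "nbrs h = C \<union> {b,c}"
  and nbrs_b: "nbrs b = {h,x,w}" and nbrs_c: "nbrs c = {h,y,w}"
  and nbrs_x: "nbrs x = C \<union> {b}" and nbrs_y: "nbrs y = C \<union> {c}"
  and nbrs_w: "nbrs w = {b,c}"
  using shape unfolding clone_shape_def by simp_all

lemma finite_C: "finite C"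
  using pair_finite_verts verts by simp

lemma card_verts: "card (pverts G) = card C + 6"
proof -
  have "card {h,b,c,x,y,w} = 6" using dist by simp
  then show ?thesis unfolding verts using disj finite_C by (subst card_Un_disjoint) auto
qed

lemma adjs:
  "v \<in> C \<Longrightarrow> v \<sim> u \<longleftrightarrow> (u \<in> C \<and> u \<noteq> v) \<or> u = h \<or> u = x \<or> u = y"
  "h \<sim> u \<longleftrightarrow> u \<in> C \<or> u = b \<or> u = c"
  "b \<sim> u \<longleftrightarrow> u = h \<or> u = x \<or> u = w"
  "c \<sim> u \<longleftrightarrow> u = h \<or> u = y \<or> u = w"
  "x \<sim> u \<longleftrightarrow> u \<in> C \<or> u = b"
  "y \<sim> u \<longleftrightarrow> u \<in> C \<or> u = c"
  "w \<sim> u \<longleftrightarrow> u = b \<or> u = c"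
  unfolding Image_singleton_iff[symmetric] nbrs_h nbrs_b nbrs_c nbrs_x nbrs_y nbrs_w
  by (simp_all only: nbrs_clone) auto

lemma near_adj: "u \<sim> v \<Longrightarrow> near u v" and near_two: "u \<sim> t \<Longrightarrow> t \<sim> v \<Longrightarrow> near u v"
  unfolding near_iff by blast+

lemma degrees:
  "v \<in> C \<Longrightarrow> card (nbrs v) = card C + 2" "card (nbrs h) = card C + 2"
  "card (nbrs b) = 3" "card (nbrs c) = 3" "card (nbrs x) = card C + 1" "card (nbrs y) = card C + 1"
  "card (nbrs w) = 2"
proof -
  show "card (nbrs v) = card C + 2" if v: "v \<in> C"
  proof -
    have "card {h,x,y} = 3" using dist by simp
    moreover have "card (C - {v} \<union> {h,x,y}) = card (C - {v}) + card {h,x,y}"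
      using disj finite_C by (intro card_Un_disjoint) auto
    moreover have "card (C - {v}) + 1 = card C"
      using v finite_C card_Suc_Diff1 by fastforce
    ultimately show ?thesis unfolding nbrs_clone[OF v] by linarith
  qed
  show "card (nbrs h) = card C + 2" "card (nbrs x) = card C + 1" "card (nbrs y) = card C + 1"
    unfolding nbrs_h nbrs_x nbrs_y using dist disj finite_C by auto
  show "card (nbrs b) = 3" "card (nbrs c) = 3" "card (nbrs w) = 2"
    unfolding nbrs_b nbrs_c nbrs_w using dist by auto
qed

lemma verts_cases:
  assumes "v \<in> pverts G"
  obtains "v \<in> C" | "v = h" | "v = b" | "v = c" | "v = x" | "v = y" | "v = w"
  using assms verts by blast

context
  assumes C_nonempty: "C \<noteq> {}"
begin

lemma near_h: "v \<in> pverts G \<Longrightarrow> near h v"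
proof -
  assume "v \<in> pverts G"
  then show ?thesis
  proof (cases rule: verts_cases)
    case 2
    then show ?thesis by (simp add: near_iff)
  qed (auto simp: adjs intro: near_adj near_two[of h b] near_two[of h c])
qed

text \<open>The far pairs are a clone and \<open>w\<close>, \<open>b\<close> and \<open>y\<close>,
  \<open>c\<close> and \<open>x\<close>; they cover every vertex except \<open>h\<close>.\<close>

lemma far_exists:
  assumes "v \<in> pverts G" "v \<noteq> h"
  shows "\<exists>u\<in>pverts G. \<not> near v u"
proof -
  obtain a where a: "a \<in> C" using C_nonempty by blast
  have ne: "a \<notin> {h,b,c,x,y,w}" using a disj by blast
  have "\<not> near a w" if "a \<in> C" for a
  proof -
    have "a \<notin> {h,b,c,x,y,w}" using that disj by blast
    then show ?thesis unfolding near_iff using adjs(7) adjs(1)[OF that] adj_sym dist disj by auto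
  qed
  moreover have "\<not> near b y" "\<not> near c x"
    unfolding near_iff using adjs dist adj_sym[of _ y] adj_sym[of _ x] disj by auto
  ultimately show ?thesis
    using assms(2) verts a near_sym by (cases rule: verts_cases[OF assms(1)]) auto
qed

text \<open>Neighbours of \<open>h\<close> go through \<open>h\<close>. From \<open>x\<close> or
  \<open>y\<close>, the vertex \<open>w\<close> is reached through \<open>b\<close> or
  \<open>c\<close> and all else through a clone; from \<open>w\<close>, the vertex \<open>y\<close>
  is reached through \<open>c\<close> and all else through \<open>b\<close>.\<close>

lemma walk_three:
  assumes "u \<in> pverts G" "v \<in> pverts G"
  shows "walk_le (parcs G) 3 u v"
proof -
  obtain a where a: "a \<in> C" using C_nonempty by blast
  have via_h: "walk_le (parcs G) 3 u v" if "u \<sim> h" for u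
    using that near_h[OF assms(2)] walk_le_three_iff by blast
  have wx: "walk_le (parcs G) 3 s v" if s: "s = x \<and> t = b \<or> s = y \<and> t = c" for s t
  proof (cases "v = w")
    case True
    then have "s \<sim> t" "near t v" using s by (auto simp: adjs near_iff)
    then show ?thesis using walk_le_three_iff by blast
  next
    case False
    have "s \<sim> a" using s a by (auto simp: adjs)
    moreover have "near a v" if "v \<noteq> w"
      using assms(2)
    proof (cases rule: verts_cases)
      case 1
      then show ?thesis using a by (cases "v = a") (auto simp: near_iff adjs)
    qed (use that a in \<open>auto simp: adjs intro: near_adj near_two[of a h]\<close>)
    ultimately show ?thesis using False walk_le_three_iff by blast
  qed
  have ww: "walk_le (parcs G) 3 w v"
  proof (cases "v = y")
    case True
    then have "w \<sim> c" "near c v" by (auto simp: adjs near_iff)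
    then show ?thesis using walk_le_three_iff by blast
  next
    case False
    have "w \<sim> b" by (auto simp: adjs)
    moreover have "near b v" if "v \<noteq> y"
      using assms(2)
    proof (cases rule: verts_cases)
      case 3
      then show ?thesis by (simp add: near_iff)
    qed (use that in \<open>auto simp: adjs intro: near_adj near_two[of b h]\<close>)
    ultimately show ?thesis using False walk_le_three_iff by blast
  qed
  have "h \<sim> a \<and> a \<sim> h" using a by (simp add: adjs)
  then have hh: "walk_le (parcs G) 3 h v"
    using near_h[OF assms(2)] unfolding walk_le_three_iff near_iff by blast
  show ?thesis
    using assms(1) by (cases rule: verts_cases) (use via_h hh wx ww adjs in auto)
qed

lemma eccentricity_other:
  assumes "v \<in> pverts G" "v \<noteq> h"
  shows "eccentricity (with_proj G) v = ereal (real 3)"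
proof (rule antisym)
  show "eccentricity (with_proj G) v \<le> ereal (real 3)"
    by (rule eccentricity_le[OF assms(1) walk_three[OF assms(1)]])
  show "ereal (real 3) \<le> eccentricity (with_proj G) v"
  proof (rule ccontr)
    assume "\<not> ?thesis"
    then have "eccentricity (with_proj G) v < ereal (real (Suc 2))" by (simp add: not_le)
    then show False using eccentricity_less_imp far_exists[OF assms] by blast
  qed
qed

lemma eccentricity_h: "eccentricity (with_proj G) h \<le> ereal (real 2)"
  by (rule eccentricity_le) (use verts near_h in auto)

lemma diameter: "graph_diameter (with_proj G) = ereal (real 3)"
  unfolding graph_diameter_def
proof (rule Max_eqI)
  show "finite (eccentricity (with_proj G) ` verts (with_proj G))" using pair_finite_verts by simp
  have "b \<in> pverts G" "b \<noteq> h" using verts dist by auto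
  then show "ereal (real 3) \<in> eccentricity (with_proj G) ` verts (with_proj G)"
    using eccentricity_other by (metis image_eqI with_proj_simps(1))
  fix e assume "e \<in> eccentricity (with_proj G) ` verts (with_proj G)"
  then obtain v where v: "v \<in> pverts G" "e = eccentricity (with_proj G) v" by auto
  show "e \<le> ereal (real 3)" unfolding v(2)
    by (rule eccentricity_le[OF v(1) walk_three[OF v(1)]])
qed

lemma almost_peripheral: "almost_peripheral (with_proj G)"
proof -
  have "eccentricity (with_proj G) h < ereal (real 3)"
    using eccentricity_h by (rule le_less_trans) simp
  then have "peripheral_verts (with_proj G) = pverts G - {h}"
    using eccentricity_other by (auto simp: peripheral_verts_def diameter)
  moreover have "h \<in> pverts G" using verts by simp
  ultimately show ?thesis
    using connectedI_walk_le[of 3] walk_three pair_finite_verts unfolding almost_peripheral_def by auto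
qed

end

lemma max_degree:
  assumes "2 \<le> card C"
  shows "max_degree (with_proj G) = card C + 2"
  unfolding max_degree_def
proof (rule Max_eqI)
  show "finite (out_degree (with_proj G) ` verts (with_proj G))" using pair_finite_verts by simp
  show "card C + 2 \<in> out_degree (with_proj G) ` verts (with_proj G)"
    by (rule image_eqI[of _ _ h]) (auto simp: out_degree_eq degrees verts)
  fix d assume "d \<in> out_degree (with_proj G) ` verts (with_proj G)"
  then obtain v where v: "v \<in> pverts G" "d = card (nbrs v)" by (auto simp: out_degree_eq)
  from v(1) show "d \<le> card C + 2"
    unfolding v(2) by (cases rule: verts_cases) (use degrees assms in simp_all)
qed

lemma ap_graph:
  assumes "2 \<le> card C"
  shows "ap_graph (card C + 6) (card C + 2) G"
  unfolding ap_graph_def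
proof (intro conjI)
  have "C \<noteq> {}" using assms by auto
  then show "almost_peripheral (with_proj G)" by (rule almost_peripheral)
qed (use card_verts max_degree assms in auto)

text \<open>Exactly \<open>h\<close> and the clones count: two clones already lift |C| + 2 above the
  degree three of \<open>b\<close> and \<open>c\<close>.\<close>

lemma card_max_degree_verts:
  assumes "2 \<le> card C"
  shows "card (verts_of_degree (with_proj G) (card C + 2)) = card C + 1"
proof -
  have "verts_of_degree (with_proj G) (card C + 2) = insert h C"
  proof (rule set_eqI)
    fix v
    show "v \<in> verts_of_degree (with_proj G) (card C + 2) \<longleftrightarrow> v \<in> insert h C"
    proof (cases "v \<in> pverts G")
      case True
      then have "card (nbrs v) = card C + 2 \<longleftrightarrow> v \<in> insert h C"
        by (cases rule: verts_cases) (use degrees assms dist disj in auto)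
      then show ?thesis using True by (simp add: verts_of_degree_def out_degree_eq)
    next
      case False
      then show ?thesis using verts by (auto simp: verts_of_degree_def)
    qed
  qed
  then show ?thesis using disj finite_C by auto
qed

end

section \<open>Isomorphisms between graphs of the extremal shape\<close>

lemma digraph_isoI_nbrs:
  assumes G: "pair_wf_digraph G" and H: "pair_wf_digraph H"
    and f: "bij_betw f (pverts G) (pverts H)"
    and nbrs: "\<And>v. v \<in> pverts G \<Longrightarrow> parcs H `` {f v} = f ` (parcs G `` {v})"
  shows "digraph_iso (with_proj G) (with_proj H)"
proof -
  interpret G: pair_wf_digraph G by fact
  interpret H: pair_wf_digraph H by fact
  let ?hom = "\<lparr>iso_verts = f, iso_arcs = map_prod f f, iso_head = snd, iso_tail = fst\<rparr>"
  have inj: "inj_on f (pverts G)" and img: "f ` pverts G = pverts H"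
    using f by (auto simp: bij_betw_def)
  have "parcs G \<subseteq> pverts G \<times> pverts G" using G.wellformed' by auto
  then have "inj_on (map_prod f f) (parcs G)"
    using map_prod_inj_on[OF inj inj] by (rule inj_on_subset[rotated])
  then have "pre_digraph.digraph_isomorphism (with_proj G) ?hom"
    using inj G.wf_digraph_axioms by (auto simp: pre_digraph.digraph_isomorphism_def)
  moreover have "map_prod f f ` parcs G = parcs H"
  proof (rule set_eqI, clarify)
    fix a b
    show "(a,b) \<in> map_prod f f ` parcs G \<longleftrightarrow> (a,b) \<in> parcs H"
    proof
      assume "(a,b) \<in> map_prod f f ` parcs G"
      then show "(a,b) \<in> parcs H" using nbrs G.in_arcsD1 by fastforce
    next
      assume ab: "(a,b) \<in> parcs H"
      then obtain v where v: "v \<in> pverts G" "a = f v" using H.in_arcsD1 img by blast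
      then have "b \<in> f ` (parcs G `` {v})" using nbrs[OF v(1)] ab by blast
      then show "(a,b) \<in> map_prod f f ` parcs G" using v by force
    qed
  qed
  ultimately show ?thesis
    unfolding digraph_iso_def using img by (intro exI[of _ ?hom]) (simp add: app_iso_def with_proj_def)
qed

text \<open>Clones are interchangeable, so any bijection between the clone sets extends by matching
  the six named vertices.\<close>

lemma clone_shape_iso:
  assumes G: "pair_graph G" "clone_shape G C h b c x y w"
    and H: "pair_graph H" "clone_shape H C' h' b' c' x' y' w'"
    and card: "card C = card C'"
  shows "digraph_iso (with_proj G) (with_proj H)"
proof -
  interpret G: clone_shaped G C h b c x y w using G by (intro clone_shaped.intro clone_shaped_axioms.intro)
  interpret H: clone_shaped H C' h' b' c' x' y' w' using H by (intro clone_shaped.intro clone_shaped_axioms.intro)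
  obtain e where e: "bij_betw e C C'"
    using finite_same_card_bij[OF G.finite_C H.finite_C card] by blast
  define f where "f v = (if v \<in> C then e v else if v = h then h' else if v = b then b'
    else if v = c then c' else if v = x then x' else if v = y then y' else w')" for v
  have fC: "f v = e v" if "v \<in> C" for v using that by (simp add: f_def)
  have f6: "f h = h'" "f b = b'" "f c = c'" "f x = x'" "f y = y'" "f w = w'"
    using G.dist G.disj by (auto simp: f_def)
  have bC: "bij_betw f C C'" using e fC by (simp cong: bij_betw_cong)
  have "bij_betw f {h,b,c,x,y,w} {h',b',c',x',y',w'}"
    unfolding bij_betw_def using f6 G.dist H.dist by auto
  then have bij: "bij_betw f (pverts G) (pverts H)"
    unfolding G.verts H.verts using H.disj by (rule bij_betw_combine[OF bC])
  have imC: "f ` C = C'" using bC by (simp add: bij_betw_def)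
  have "parcs H `` {f v} = f ` (parcs G `` {v})" if "v \<in> pverts G" for v
    using that
  proof (cases rule: G.verts_cases)
    assume v: "v \<in> C"
    then have "f v \<in> C'" using imC by blast
    moreover have "f ` (C - {v}) = C' - {f v}"
      using inj_on_image_set_diff[of f C C "{v}"] bC v by (auto simp: bij_betw_def)
    ultimately show ?thesis
      by (simp only: G.nbrs_clone[OF v] H.nbrs_clone image_Un image_insert image_empty f6)
  qed (simp_all only: G.nbrs_h G.nbrs_b G.nbrs_c G.nbrs_x G.nbrs_y G.nbrs_w
      H.nbrs_h H.nbrs_b H.nbrs_c H.nbrs_x H.nbrs_y H.nbrs_w f6 image_Un image_insert image_empty imC)
  then show ?thesis
    using digraph_isoI_nbrs[OF _ _ bij] G.pair_wf_digraph H.pair_wf_digraph by blast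
qed

lemma digraph_iso_card_verts_of_degree:
  assumes "digraph_iso G H"
  shows "card (verts_of_degree G d) = card (verts_of_degree H d)"
proof -
  obtain f where f: "pre_digraph.digraph_isomorphism G f" "H = app_iso f G"
    using assms by (auto simp: digraph_iso_def)
  have "verts_of_degree H d = iso_verts f ` verts_of_degree G d"
    using wf_digraph.out_degree_app_iso_eq[OF _ f(1)] f(1)
    by (auto simp: verts_of_degree_def f(2) pre_digraph.digraph_isomorphism_def)
  moreover have "inj_on (iso_verts f) (verts_of_degree G d)"
    using pre_digraph.digraph_isomorphism_inj_on_verts[OF f(1)]
    by (rule inj_on_subset) (auto simp: verts_of_degree_def)
  ultimately show ?thesis by (simp add: card_image)
qed

section \<open>The explicit construction has the extremal shape\<close>

lemma arcs_subdivided_K4: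
  "(u,v) \<in> parcs subdivided_K4 \<longleftrightarrow> (case u of
      VH \<Rightarrow> v \<in> {VA,VB,VC} | VA \<Rightarrow> v \<in> {VH,SAB,SCA} | VB \<Rightarrow> v \<in> {VH,SAB,SBC} | VC \<Rightarrow> v \<in> {VH,SCA,SBC}
    | SAB \<Rightarrow> v \<in> {VA,VB} | SCA \<Rightarrow> v \<in> {VA,VC} | SBC \<Rightarrow> v \<in> {VB,VC} | Clone i \<Rightarrow> False)"
  by (cases u; cases v; simp add: subdivided_K4_def complete_on_def subdivide_simps)

lemma arcs_replace_by_complete:
  "(u,v) \<in> parcs (replace_by_complete G a S) \<longleftrightarrow>
     (u,v) \<in> parcs G \<and> u \<noteq> a \<and> v \<noteq> a \<or> u \<in> S \<and> v \<in> S \<and> u \<noteq> v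
     \<or> u \<in> S \<and> (a,v) \<in> parcs G \<or> v \<in> S \<and> (u,a) \<in> parcs G"
  by (auto simp: replace_by_complete_def complete_on_def)

lemma arcs_extremal_graph:
  "(u,v) \<in> parcs (extremal_graph n) \<longleftrightarrow> (case u of
      Clone i \<Rightarrow> i < n - 6 \<and> (v \<in> Clone ` {..<n - 6} - {u} \<union> {VH,SAB,SCA})
    | VH \<Rightarrow> v \<in> Clone ` {..<n - 6} \<union> {VB,VC}
    | VA \<Rightarrow> False
    | VB \<Rightarrow> v \<in> {VH,SAB,SBC}
    | VC \<Rightarrow> v \<in> {VH,SCA,SBC}
    | SAB \<Rightarrow> v \<in> Clone ` {..<n - 6} \<union> {VB}
    | SCA \<Rightarrow> v \<in> Clone ` {..<n - 6} \<union> {VC}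
    | SBC \<Rightarrow> v \<in> {VB,VC})"
  unfolding extremal_graph_def arcs_replace_by_complete
  by (cases u; cases v) (auto simp: arcs_subdivided_K4)

lemma verts_extremal_graph:
  "pverts (extremal_graph n) = Clone ` {..<n - 6} \<union> {VH,VB,VC,SAB,SCA,SBC}"
  by (auto simp: extremal_graph_def replace_by_complete_def subdivided_K4_def complete_on_def subdivide_simps)

lemma pair_graph_extremal_graph: "pair_graph (extremal_graph n)"
proof -
  let ?G = "extremal_graph n"
  have wf: "u \<in> pverts ?G \<and> v \<in> pverts ?G \<and> u \<noteq> v \<and> (v,u) \<in> parcs ?G" if "(u,v) \<in> parcs ?G" for u v
    using that unfolding arcs_extremal_graph verts_extremal_graph by (cases u; cases v) auto
  have fin: "finite (pverts ?G)" by (simp add: verts_extremal_graph)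
  have "parcs ?G \<subseteq> pverts ?G \<times> pverts ?G" using wf by auto
  then have "finite (parcs ?G)" using fin finite_subset by blast
  moreover have "symmetric ?G"
    unfolding symmetric_def using wf by (auto intro: symI)
  ultimately show ?thesis using wf fin by unfold_locales auto
qed

lemma clone_shape_extremal_graph:
  "clone_shape (extremal_graph n) (Clone ` {..<n - 6}) VH VB VC SAB SCA SBC"
  unfolding clone_shape_def verts_extremal_graph by (auto simp: arcs_extremal_graph)

theorem theorem11:
  fixes n :: nat
  assumes "n \<ge> 8"
  shows "ap_graph n (n - 4) (extremal_graph n)
    \<and> card (verts_of_degree (with_proj (extremal_graph n)) (n - 4)) = n - 5
    \<and> (\<forall>G :: 'a pair_pre_digraph. ap_graph n (n - 4) G \<longrightarrow>
          card (verts_of_degree (with_proj G) (n - 4)) \<le> n - 5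
        \<and> (card (verts_of_degree (with_proj G) (n - 4)) = n - 5
            \<longleftrightarrow> digraph_iso (with_proj G) (with_proj (extremal_graph n))))"
proof -
  let ?H = "extremal_graph n" and ?C = "Clone ` {..<n - 6}"
  interpret H: clone_shaped ?H ?C VH VB VC SAB SCA SBC
    using pair_graph_extremal_graph clone_shape_extremal_graph
    by (intro clone_shaped.intro clone_shaped_axioms.intro)
  have card_C: "card ?C = n - 6" by (simp add: card_image inj_on_def)
  have eqs: "n - 6 + 6 = n" "n - 6 + 2 = n - 4" "n - 6 + 1 = n - 5" "2 \<le> n - 6" using assms by auto
  have ap: "ap_graph n (n - 4) ?H" using H.ap_graph unfolding card_C eqs(1,2) by (simp add: eqs)
  have count: "card (verts_of_degree (with_proj ?H) (n - 4)) = n - 5"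
    using H.card_max_degree_verts unfolding card_C eqs(2,3) by (simp add: eqs)
  \<comment> \<open>The hypothesis is an inequality: a graph with more than \<open>n - 5\<close>
    such vertices would also be isomorphic to the extremal graph, which has exactly
    \<open>n - 5\<close>, so the upper bound follows as well.\<close>
  have iso: "digraph_iso (with_proj G) (with_proj ?H)"
    if G: "ap_graph n (n - 4) G" "n - 5 \<le> card (verts_of_degree (with_proj G) (n - 4))"
    for G :: "'a pair_pre_digraph"
  proof -
    obtain z where z: "critical_graph G z" using critical_graph_exists[OF assms G] by blast
    obtain C h b c x y w where shape: "clone_shape G C h b c x y w"
      using critical_graph.clone_shape_exists[OF z] by (elim exE) (rule that)
    have pg: "pair_graph G" using G by (simp add: ap_graph_def)
    interpret G: clone_shaped G C h b c x y w
      using pg shape by (intro clone_shaped.intro clone_shaped_axioms.intro)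
    have "card (pverts G) = n" using G by (simp add: ap_graph_def)
    then have "card C = card ?C" using G.card_verts card_C by linarith
    then show ?thesis
      using clone_shape_iso[OF pg shape pair_graph_extremal_graph clone_shape_extremal_graph] by blast
  qed
  have "card (verts_of_degree (with_proj G) (n - 4)) \<le> n - 5
      \<and> (card (verts_of_degree (with_proj G) (n - 4)) = n - 5
            \<longleftrightarrow> digraph_iso (with_proj G) (with_proj ?H))"
    if "ap_graph n (n - 4) G" for G :: "'a pair_pre_digraph"
    using iso[OF that] digraph_iso_card_verts_of_degree[of "with_proj G" "with_proj ?H" "n - 4"] count
    by (metis linorder_le_cases order_refl)
  then show ?thesis using ap count by blast
qed

end
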